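(* Let $d\ge 1$, $a,w_1,\dots,w_d\in\mathcal H$, and $\bm w=(w_1,\dots,w_d)$. Then $$\begin{aligned} \zeta_{\rm B}'(0,a|\bm w)={}&\lim_{M\to\infty}\Biggl[-H_dM^d+\sum_{m=0}^{d}\frac{{}_dS_m^{(d)}(0)}{m!\,(d-m)!}F\bigl[(a+x)^{d-m}\log(a+x)\bigr]_{x=M\bm w}\\ &\qquad-\sum_{\bm n\in\mathcal C_{M-1}}\log(a+\bm n\cdot\bm w)\Biggr]+(-1)^d\sum_{m=0}^{d}\frac{{}_dS_m^{(d)}(0)\,H_{d-m}}{m!\,(d-m)!}a^{d-m}, \end{aligned}$$ where the limit is over positive integers $M$.
   Context: $\mathcal H=\{z\in\mathbb C:\theta-\frac{\pi}{2}<\arg z<\theta+\frac{\pi}{2}\}$ is a fixed open half-plane ($\theta$ a fixed real angle), and $\log$ is a fixed holomorphic branch of the logarithm on $\mathcal H$; $z^s=\exp(s\log z)$ for $z\in\mathcal H$. $\mathbb N_0=\{0,1,2,\dots\}$, $\bm n\cdot\bm w=\sum_{i=1}^d n_iw_i$, and $\mathcal C_M=\{0,1,\dots,M\}^d$. The Barnes zeta function is $\zeta_{\rm B}(\alpha,a|\bm w)=\sum_{\bm n\in\mathbb N_0^d}(a+\bm n\cdot\bm w)^{-\alpha}$ for $\Re(\alpha)>d$; it extends meromorphically in $\alpha$ to $\mathbb C$, with at most simple poles, located at $\alpha=1,\dots,d$. The prime in $\zeta_{\rm B}'$ denotes the derivative with respect to $\alpha$. For $\bm v\in\mathbb C^d$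 and a function $g$ of $x$, $F[g(x)]_{x=\bm v}=\sum_{\emptyset\ne S\subseteq\{1,\dots,d\}}(-1)^{d-|S|}g\bigl(\sum_{i\in S}v_i\bigr)$. Harmonic numbers: $H_k=\sum_{i=1}^k 1/i$, $H_0=0$. The higher order Bernoulli polynomials $B_n(a|\bm w)$ are defined by $z^d{\rm e}^{az}\prod_{i=1}^d\frac{w_i}{{\rm e}^{w_iz}-1}=\sum_{n\ge0}B_n(a|\bm w)\frac{z^n}{n!}$ for $|z|<2\pi/\max_i|w_i|$. The Bernoullian functions ${}_dS_n(a)$ ($n\ge0$; dependence on $\bm w$ suppressed) are the polynomials in $a$ with ${}_dS_n(0)=0$ and ${}_dS_n'(a)=\frac{n!}{(n+d-1)!\,\prod_{i=1}^dw_i}B_{n+d-1}(a|\bm w)$; ${}_dS_m^{(d)}(0)$ is the $d$-th derivative in $a$ at $a=0$ (equivalently ${}_dS_m^{(d)}(0)=B_m(0|\bm w)/\prod_{i=1}^dw_i$). *)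

theory Defs
  imports "HOL-Complex_Analysis.Complex_Analysis"
begin

text \<open>
  Vectors in dimension \<open>d\<close> are functions on \<open>nat\<close> of which only the values on \<open>{1..d}\<close> are
  used; multi-indices are the extensional functions on \<open>{1..d}\<close>, so that each
  multi-index is represented exactly once.
\<close>

definition half_plane :: "real \<Rightarrow> complex set" where
  "half_plane \<theta> = {z. z \<noteq> 0 \<and> (\<exists>\<phi>. is_Arg z \<phi> \<and> \<theta> - pi / 2 < \<phi> \<and> \<phi> < \<theta> + pi / 2)}"

definition log_branch_on :: "(complex \<Rightarrow> complex) \<Rightarrow> complex set \<Rightarrow> bool" where
  "log_branch_on L A \<longleftrightarrow> L holomorphic_on A \<and> (\<forall>z\<in>A. exp (L z) = z)"

definition branch_power :: "(complex \<Rightarrow> complex) \<Rightarrow> complex \<Rightarrow> complex \<Rightarrow> complex" where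
  "branch_power L z s = exp (s * L z)"

definition multi_dot :: "nat \<Rightarrow> (nat \<Rightarrow> nat) \<Rightarrow> (nat \<Rightarrow> complex) \<Rightarrow> complex" where
  "multi_dot d n w = (\<Sum>i=1..d. of_nat (n i) * w i)"

definition multi_cube :: "nat \<Rightarrow> nat \<Rightarrow> (nat \<Rightarrow> nat) set" where
  "multi_cube d M = ({1..d} \<rightarrow>\<^sub>E {0..M})"

definition alt_subset_sum :: "nat \<Rightarrow> (complex \<Rightarrow> complex) \<Rightarrow> (nat \<Rightarrow> complex) \<Rightarrow> complex" where
  "alt_subset_sum d g v =
     (\<Sum>S\<in>{S. S \<noteq> {} \<and> S \<subseteq> {1..d}}. (-1) ^ (d - card S) * g (\<Sum>i\<in>S. v i))"

text \<open>
  The Barnes zeta function \<open>\<zeta>\<^sub>B(\<alpha>, a | w)\<close> is the meromorphic continuation to the whole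
  plane of its defining series. Asking for \<open>nicely_meromorphic_on\<close> instead of
  \<open>meromorphic_on\<close> only normalises the values at poles (to \<open>0\<close>) and at removable
  singularities, which makes the continuation unique as a total function.
\<close>

definition barnes_zeta ::
  "(complex \<Rightarrow> complex) \<Rightarrow> nat \<Rightarrow> complex \<Rightarrow> complex \<Rightarrow> (nat \<Rightarrow> complex) \<Rightarrow> complex" where
  "barnes_zeta L d \<alpha> a w =
     (THE Z. Z nicely_meromorphic_on UNIV \<and>
        (\<forall>s. Re s > real d \<longrightarrow>
           ((\<lambda>n. branch_power L (a + multi_dot d n w) (- s)) has_sum Z s)
             ({1..d} \<rightarrow>\<^sub>E UNIV))) \<alpha>"

text \<open>
  The generating function \<open>z\<^sup>d e\<^sup>a\<^sup>z \<Prod>\<^sub>i w\<^sub>i / (e\<^bsup>w\<^sub>i z\<^esup> - 1)\<close> is read as a formal power series,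
  with the factor \<open>z\<^sup>d\<close> distributed over the product because each quotient
  \<open>w\<^sub>i / (e\<^bsup>w\<^sub>i z\<^esup> - 1)\<close> alone has a pole at \<open>0\<close> and is not a power series. The lemma
  \<open>higher_bernoulli_sums\<close> below is the analytic form.
\<close>

definition higher_bernoulli :: "nat \<Rightarrow> nat \<Rightarrow> complex \<Rightarrow> (nat \<Rightarrow> complex) \<Rightarrow> complex" where
  "higher_bernoulli d n a w =
     fact n * fps_nth (fps_exp a *
       (\<Prod>i=1..d. fps_const (w i) * fps_X / (fps_exp (w i) - 1))) n"

definition bernoullian_poly :: "nat \<Rightarrow> nat \<Rightarrow> (nat \<Rightarrow> complex) \<Rightarrow> complex poly" where
  "bernoullian_poly d n w =
     (THE p. poly p 0 = 0 \<and>
        (\<forall>a. poly (pderiv p) a =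
           fact n / (fact (n + d - 1) * (\<Prod>i=1..d. w i)) * higher_bernoulli d (n + d - 1) a w))"

definition bernoullian_deriv0 :: "nat \<Rightarrow> nat \<Rightarrow> (nat \<Rightarrow> complex) \<Rightarrow> complex" where
  "bernoullian_deriv0 d m w = poly ((pderiv ^^ d) (bernoullian_poly d m w)) 0"

lemma exp_mult_eq_1_imp:
  fixes c z :: complex
  assumes "c \<noteq> 0" "z \<noteq> 0" "norm z * norm c < 2 * pi"
  shows "exp (c * z) \<noteq> 1"
proof
  assume "exp (c * z) = 1"
  then obtain n :: int where n: "Re (c * z) = 0" "Im (c * z) = of_int (2 * n) * pi"
    by (auto simp: exp_eq_1)
  have nz: "c * z \<noteq> 0" using assms by simp
  have "n \<noteq> 0"
    using n nz by (auto simp: complex_eq_iff simp del: mult_eq_0_iff)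
  then have "1 \<le> \<bar>real_of_int n\<bar>" by linarith
  then have "2 * pi * 1 \<le> 2 * pi * \<bar>real_of_int n\<bar>"
    by (intro mult_left_mono) auto
  also have "\<dots> = \<bar>Im (c * z)\<bar>" by (simp add: n(2) abs_mult del: times_complex.sel)
  also have "\<dots> \<le> norm (c * z)" by (rule abs_Im_le_cmod)
  finally show False using assms(3) by (simp add: norm_mult mult.commute)
qed

lemma higher_bernoulli_sums:
  fixes a z :: complex and w :: "nat \<Rightarrow> complex"
  assumes "d \<ge> 1" and w: "\<And>i. i \<in> {1..d} \<Longrightarrow> w i \<noteq> 0"
    and "z \<noteq> 0" and "norm z < 2 * pi / Max ((\<lambda>i. norm (w i)) ` {1..d})"
  shows "(\<lambda>n. higher_bernoulli d n a w * z ^ n / fact n) sums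
           (z ^ d * exp (a * z) * (\<Prod>i=1..d. w i / (exp (w i * z) - 1)))"
proof -
  define m where "m = Max ((\<lambda>i. norm (w i)) ` {1..d})"
  define r where "r = 2 * pi / m"
  have le_m: "norm (w i) \<le> m" if "i \<in> {1..d}" for i
    unfolding m_def using that by (intro Max_ge) auto
  have "m > 0"
    using le_m[of 1] w[of 1] assms(1)
    by (smt (verit) atLeastAtMost_iff le_refl zero_less_norm_iff)
  then have "r > 0" by (simp add: r_def)
  define q where "q = (\<lambda>i z. if z = 0 then 1 else w i * z / (exp (w i * z) - 1))"
  define Q where "Q = (\<lambda>i. fps_const (w i) * fps_X / (fps_exp (w i) - 1))"
  have exp_q: "q i has_fps_expansion Q i" if i: "i \<in> {1..d}" for i
  proof -
    have c: "w i \<noteq> 0" using w i by blast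
    have sd: "subdegree (fps_exp (w i) - 1) = 1"
      using c by (intro subdegreeI) auto
    have nz: "fps_exp (w i) - 1 \<noteq> 0" using sd by auto
    show ?thesis
      unfolding q_def Q_def
      by (rule has_fps_expansion_divide)
         (use c sd nz in \<open>auto intro!: fps_expansion_intros simp: subdegree_eq_0_iff\<close>)
  qed
  have nz: "exp (w i * u) \<noteq> 1" if "i \<in> {1..d}" "u \<in> ball 0 r" "u \<noteq> 0" for i u
  proof (rule exp_mult_eq_1_imp)
    have "norm u * norm (w i) \<le> norm u * m"
      using le_m that by (intro mult_left_mono) auto
    also have "\<dots> < r * m" using that \<open>m > 0\<close> by simp
    also have "\<dots> = 2 * pi" using \<open>m > 0\<close> by (simp add: r_def)
    finally show "norm u * norm (w i) < 2 * pi" .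
  qed (use w that in auto)
  have hol_q: "q i holomorphic_on ball 0 r" if i: "i \<in> {1..d}" for i
  proof (rule no_isolated_singularity)
    have "(\<lambda>z. w i * z / (exp (w i * z) - 1)) holomorphic_on ball 0 r - {0}"
      by (intro holomorphic_intros) (use nz i in auto)
    then show hol: "q i holomorphic_on ball 0 r - {0}"
      by (rule holomorphic_transform) (auto simp: q_def)
    have "isCont (q i) u" if "u \<in> ball 0 r" for u
    proof (cases "u = 0")
      case True
      then show ?thesis
        using has_fps_expansion_imp_analytic_0[OF exp_q[OF i]] analytic_at_imp_isCont by blast
    next
      case False
      have "open (ball 0 r - {0} :: complex set)" by auto
      then have "continuous (at u) (q i)"
        using holomorphic_on_imp_continuous_on[OF hol] False that
        by (simp add: continuous_on_eq_continuous_at)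
      then show ?thesis .
    qed
    then show "continuous_on (ball 0 r) (q i)"
      by (simp add: continuous_on_eq_continuous_at)
  qed auto
  have "(\<lambda>u. exp (a * u) * (\<Prod>i=1..d. q i u)) has_fps_expansion fps_exp a * (\<Prod>i=1..d. Q i)"
    by (intro fps_expansion_intros has_fps_expansion_prod exp_q) auto
  moreover have "(\<lambda>u. exp (a * u) * (\<Prod>i=1..d. q i u)) holomorphic_on eball 0 r"
    by (intro holomorphic_intros) (use hol_q in auto)
  moreover have "z \<in> eball 0 r"
    using assms(4) by (simp add: r_def m_def in_eball_iff)
  ultimately have "(\<lambda>n. fps_nth (fps_exp a * (\<Prod>i=1..d. Q i)) n * z ^ n) sums
      (exp (a * z) * (\<Prod>i=1..d. q i z))"
    using has_fps_expansion_imp_sums_complex by fastforce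
  moreover have "(\<Prod>i=1..d. q i z) = z ^ d * (\<Prod>i=1..d. w i / (exp (w i * z) - 1))"
    using assms(3) by (simp add: q_def prod.distrib prod_dividef)
  ultimately show ?thesis
    by (simp add: higher_bernoulli_def Q_def mult_ac)
qed

end

theory Submission
  imports Defs
begin

text \<open>
  Idea: Euler--Maclaurin summation in all \<open>d\<close> directions at once. Let \<open>D = d/dy\<close>, let \<open>b\<^sub>m\<close> be the Taylor
  coefficients of \<open>\<Prod>\<^sub>i z / (e\<^bsup>w\<^sub>i z\<^esup> - 1)\<close>, and put \<open>G = \<Sum>\<^sub>m\<^sub>\<le>\<^sub>N b\<^sub>m D\<^bsup>m-d\<^esup> y\<^bsup>-\<alpha>\<^esup>\<close>. The iterated difference of \<open>G\<close> with
  steps \<open>w\<^sub>1, \<dots>, w\<^sub>d\<close> is \<open>y\<^bsup>-\<alpha>\<^esup>\<close> up to \<open>O(|y|\<^bsup>-Re \<alpha> - N - 1\<^esup>)\<close>, because \<open>\<Prod>\<^sub>i (e\<^bsup>w\<^sub>i D\<^esup> - 1)\<close> is the difference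
  operator. Summed over a cube, the difference telescopes to the corner values of \<open>G\<close>, and the remainder
  series converges locally uniformly for \<open>Re \<alpha> > d - N - 1\<close>. This continues the zeta function, and for
  \<open>N = d\<close> the derivatives at \<open>\<alpha> = 0\<close> of the approximants with finitely many terms are the bracket of the
  theorem, up to the constant term.
\<close>

subsection \<open>Iterated differences and Bernoulli coefficients\<close>

text \<open>Unlike \<open>alt_subset_sum\<close>, the empty subset is included, so this is the
  composition of the one-step differences g(x + v_i) - g(x). The values lie in any commutative ring,
  so that g may also be \<open>fps_exp\<close>.\<close>

definition iterated_diff ::
  "'i set \<Rightarrow> ('i \<Rightarrow> 'a) \<Rightarrow> ('a \<Rightarrow> 'b) \<Rightarrow> 'a :: comm_monoid_add \<Rightarrow> 'b :: comm_ring_1" where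
  "iterated_diff I v g x = (\<Sum>S\<in>Pow I. (-1) ^ card (I - S) * g (x + sum v S))"

lemma iterated_diff_empty [simp]: "iterated_diff {} v g x = g x"
  by (simp add: iterated_diff_def)

lemma iterated_diff_insert:
  assumes "finite I" "i \<notin> I"
  shows "iterated_diff (insert i I) v g x = iterated_diff I v g (x + v i) - iterated_diff I v g x"
proof -
  have "iterated_diff (insert i I) v g x =
      (\<Sum>S\<in>Pow I. (-1) ^ card (insert i I - S) * g (x + sum v S)) +
      (\<Sum>S\<in>insert i ` Pow I. (-1) ^ card (insert i I - S) * g (x + sum v S))"
    unfolding iterated_diff_def Pow_insert by (rule sum.union_disjoint) (use assms in auto)
  also have "(\<Sum>S\<in>insert i ` Pow I. (-1) ^ card (insert i I - S) * g (x + sum v S)) =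
      (\<Sum>S\<in>Pow I. (-1) ^ card (insert i I - insert i S) * g (x + sum v (insert i S)))"
    by (rule sum.reindex[unfolded o_def]) (use assms in \<open>auto simp: inj_on_def\<close>)
  also have "\<dots> = iterated_diff I v g (x + v i)"
    unfolding iterated_diff_def
  proof (rule sum.cong)
    fix S assume S: "S \<in> Pow I"
    then have "finite S" "i \<notin> S" "insert i I - insert i S = I - S"
      using assms finite_subset by auto
    then show "(-1) ^ card (insert i I - insert i S) * g (x + sum v (insert i S)) =
        (-1) ^ card (I - S) * g (x + v i + sum v S)"
      by (simp add: add_ac)
  qed simp
  also have "(\<Sum>S\<in>Pow I. (-1) ^ card (insert i I - S) * g (x + sum v S)) = - iterated_diff I v g x"
    unfolding iterated_diff_def sum_negf[symmetric]
  proof (rule sum.cong)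
    fix S assume S: "S \<in> Pow I"
    then have "finite (I - S)" "i \<notin> I - S" "insert i I - S = insert i (I - S)"
      using assms by auto
    then show "(-1) ^ card (insert i I - S) * g (x + sum v S) = - ((-1) ^ card (I - S) * g (x + sum v S))"
      by simp
  qed simp
  finally show ?thesis by simp
qed

lemma sum_PiE_insert:
  fixes h :: "('i \<Rightarrow> 'c) \<Rightarrow> 'b :: comm_monoid_add"
  assumes "i \<notin> I"
  shows "(\<Sum>n\<in>insert i I \<rightarrow>\<^sub>E K. h n) = (\<Sum>k\<in>K. \<Sum>n\<in>I \<rightarrow>\<^sub>E K. h (n(i := k)))"
proof -
  have "(\<Sum>n\<in>insert i I \<rightarrow>\<^sub>E K. h n) = (\<Sum>p\<in>K \<times> (I \<rightarrow>\<^sub>E K). h ((\<lambda>(y, g). g(i := y)) p))"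
    unfolding PiE_insert_eq
    using inj_combinator[OF assms, of "\<lambda>_. K"] by (simp add: sum.reindex)
  then show ?thesis
    by (simp add: sum.cartesian_product case_prod_unfold)
qed

text \<open>One-step differences telescope along each coordinate, and the directions are treated one
  after the other. The steps w_i thereby become M w_i, and only the corners of the cube
  remain.\<close>

lemma sum_iterated_diff_cube:
  fixes g :: "complex \<Rightarrow> complex"
  assumes "finite I"
  shows "(\<Sum>n\<in>I \<rightarrow>\<^sub>E {..<M}. iterated_diff I w g (x + (\<Sum>i\<in>I. of_nat (n i) * w i))) =
         iterated_diff I (\<lambda>i. of_nat M * w i) g x"
  using assms
proof (induction I arbitrary: x rule: finite_induct)
  case empty
  then show ?case by simp
next
  case (insert i I)
  let ?D = "iterated_diff I (\<lambda>i. of_nat M * w i) g"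
  have dot: "(\<Sum>j\<in>insert i I. of_nat ((n(i := k)) j) * w j) =
      of_nat k * w i + (\<Sum>j\<in>I. of_nat (n j) * w j)" for k and n :: "'a \<Rightarrow> nat"
    using insert.hyps by (auto intro!: sum.cong)
  have "(\<Sum>n\<in>insert i I \<rightarrow>\<^sub>E {..<M}.
          iterated_diff (insert i I) w g (x + (\<Sum>j\<in>insert i I. of_nat (n j) * w j))) =
      (\<Sum>k<M. \<Sum>n\<in>I \<rightarrow>\<^sub>E {..<M}.
          iterated_diff I w g (x + of_nat (Suc k) * w i + (\<Sum>j\<in>I. of_nat (n j) * w j)) -
          iterated_diff I w g (x + of_nat k * w i + (\<Sum>j\<in>I. of_nat (n j) * w j)))"
    unfolding sum_PiE_insert[OF insert.hyps(2)] dot iterated_diff_insert[OF insert.hyps]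
    by (intro sum.cong refl) (simp add: algebra_simps)
  also have "\<dots> = (\<Sum>k<M. ?D (x + of_nat (Suc k) * w i) - ?D (x + of_nat k * w i))"
    by (simp only: sum_subtractf insert.IH)
  also have "\<dots> = ?D (x + of_nat M * w i) - ?D x"
    by (subst sum_lessThan_telescope) simp
  also have "\<dots> = iterated_diff (insert i I) (\<lambda>i. of_nat M * w i) g x"
    by (simp only: iterated_diff_insert[OF insert.hyps])
  finally show ?case .
qed

lemma iterated_diff_eq_alt_subset_sum:
  "iterated_diff {1..d} v g x = (-1) ^ d * g x + alt_subset_sum d (\<lambda>y. g (x + y)) v"
proof -
  have "iterated_diff {1..d} v g x = (\<Sum>S\<in>insert {} {S. S \<noteq> {} \<and> S \<subseteq> {1..d}}.
      (-1) ^ card ({1..d} - S) * g (x + (\<Sum>i\<in>S. v i)))"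
    unfolding iterated_diff_def by (intro sum.cong) auto
  also have "\<dots> = (-1) ^ d * g x + alt_subset_sum d (\<lambda>y. g (x + y)) v"
    unfolding alt_subset_sum_def
    by (subst sum.insert) (auto intro!: sum.cong simp: card_Diff_subset finite_subset)
  finally show ?thesis .
qed

lemma iterated_diff_linear_combination:
  "iterated_diff I v (\<lambda>y. \<Sum>k\<in>K. c k * f k y) x = (\<Sum>k\<in>K. c k * iterated_diff I v (f k) x)"
  unfolding iterated_diff_def sum_distrib_left
  by (subst sum.swap) (simp add: mult_ac)

text \<open>As a function of y, e^(yz) is an eigenfunction: a step v_i multiplies it by e^(v_i z) -
  1. Since y^k / k! is its coefficient of z^k, this is the generating function for the differences
  of all powers.\<close>

lemma iterated_diff_fps_exp:
  fixes v :: "'i \<Rightarrow> complex"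
  assumes "finite I"
  shows "iterated_diff I v fps_exp x = fps_exp x * (\<Prod>i\<in>I. fps_exp (v i) - 1)"
  using assms
proof (induction I arbitrary: x rule: finite_induct)
  case (insert i I)
  then show ?case
    by (simp add: iterated_diff_insert fps_exp_add_mult algebra_simps)
qed simp

lemma iterated_diff_power:
  fixes v :: "'i \<Rightarrow> complex"
  assumes "finite I"
  shows "iterated_diff I v (\<lambda>y. y ^ k) x =
         fact k * fps_nth (fps_exp x * (\<Prod>i\<in>I. fps_exp (v i) - 1)) k"
proof -
  have "fps_nth ((-1) ^ n * F) k = (-1) ^ n * fps_nth F k" for n and F :: "complex fps"
    by (induction n) simp_all
  then have "fps_nth (iterated_diff I v fps_exp x) k = iterated_diff I v (\<lambda>y. y ^ k / fact k) x"
    by (simp add: iterated_diff_def fps_sum_nth)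
  then show ?thesis
    unfolding iterated_diff_fps_exp[OF assms]
    by (simp add: iterated_diff_def field_simps flip: sum_divide_distrib)
qed

text \<open>Each factor e^(v_i z) - 1 has zero constant term. The resulting order
  \<open>card I\<close> is why a difference in that many directions kills all powers of lower
  degree.\<close>

lemma prod_fps_exp_minus_1:
  fixes v :: "'i \<Rightarrow> complex"
  assumes "finite I"
  shows "(\<Prod>i\<in>I. fps_exp (v i) - 1) = fps_X ^ card I * (\<Prod>i\<in>I. fps_shift 1 (fps_exp (v i) - 1))"
proof -
  have "fps_exp (v i) - 1 = fps_X * fps_shift 1 (fps_exp (v i) - 1)" for i
    by (subst fps_shift_times_fps_X'[symmetric]) (auto simp: fps_eq_iff)
  then have "(\<Prod>i\<in>I. fps_exp (v i) - 1) = (\<Prod>i\<in>I. fps_X * fps_shift 1 (fps_exp (v i) - 1))"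
    by (intro prod.cong) auto
  then show ?thesis by (simp add: prod.distrib)
qed

lemma iterated_diff_power_less:
  fixes v :: "'i \<Rightarrow> complex"
  assumes "finite I" "k < card I"
  shows "iterated_diff I v (\<lambda>y. y ^ k) x = 0"
  using assms
  by (simp add: iterated_diff_power prod_fps_exp_minus_1 mult.left_commute[of _ "fps_X ^ _"]
        fps_X_power_mult_nth)

lemma iterated_diff_power_card:
  fixes v :: "'i \<Rightarrow> complex"
  assumes "finite I"
  shows "iterated_diff I v (\<lambda>y. y ^ card I) x = fact (card I) * prod v I"
proof -
  have "fps_nth (\<Prod>i\<in>I. fps_shift 1 (fps_exp (v i) - 1)) 0 = prod v I"
    using assms by (induction I rule: finite_induct) simp_all
  then show ?thesis
    using assms
    by (simp add: iterated_diff_power prod_fps_exp_minus_1 mult.left_commute[of _ "fps_X ^ _"]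
          fps_X_power_mult_nth)
qed

section \<open>The generating series of the numbers B_m(0|w)\<close>

definition bernoulli_fps :: "nat \<Rightarrow> (nat \<Rightarrow> complex) \<Rightarrow> complex fps" where
  "bernoulli_fps d w = (\<Prod>i=1..d. fps_const (w i) * fps_X / (fps_exp (w i) - 1))"

text \<open>For nonzero w_i both sides of each quotient have order 1, so the division of power
  series is exact. Hence the Bernoulli series inverts the symbol of the difference operator up to
  z^d and a constant.\<close>

lemma bernoulli_fps_times:
  assumes "\<And>i. i \<in> {1..d} \<Longrightarrow> w i \<noteq> 0"
  shows "bernoulli_fps d w * (\<Prod>i=1..d. fps_exp (w i) - 1) = fps_const (\<Prod>i=1..d. w i) * fps_X ^ d"
proof -
  have "bernoulli_fps d w * (\<Prod>i=1..d. fps_exp (w i) - 1) = (\<Prod>i=1..d. fps_const (w i) * fps_X)"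
    unfolding bernoulli_fps_def prod.distrib[symmetric]
  proof (rule prod.cong)
    fix i assume "i \<in> {1..d}"
    then have i: "w i \<noteq> 0" using assms by blast
    have sd: "subdegree (fps_exp (w i) - 1) = 1" using i by (intro subdegreeI) auto
    then have "fps_exp (w i) - 1 \<noteq> 0" by auto
    moreover from this have "fps_exp (w i) - 1 dvd fps_const (w i) * fps_X"
      using i sd by (subst fps_dvd_iff) auto
    ultimately show "fps_const (w i) * fps_X / (fps_exp (w i) - 1) * (fps_exp (w i) - 1) =
        fps_const (w i) * fps_X" by simp
  qed simp
  also have "\<dots> = fps_const (\<Prod>i=1..d. w i) * fps_X ^ d"
    by (induction d) (simp_all add: prod.nat_ivl_Suc' algebra_simps flip: fps_const_mult)
  finally show ?thesis .
qed

lemma higher_bernoulli_eq_sum: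
  "higher_bernoulli d n a w =
     fact n * (\<Sum>i\<le>n. a ^ i / fact i * fps_nth (bernoulli_fps d w) (n - i))"
  unfolding higher_bernoulli_def bernoulli_fps_def[symmetric] fps_mult_nth atMost_atLeast0
  by simp

text \<open>The definite description is resolved by an explicit antiderivative; two candidates
  differ by a constant, and their value at 0 forces it to vanish.\<close>

lemma bernoullian_deriv0_eq:
  assumes "d \<ge> 1"
  shows "bernoullian_deriv0 d m w = fact m * fps_nth (bernoulli_fps d w) m / (\<Prod>i=1..d. w i)"
proof -
  define n where "n = m + d - 1"
  define C where "C = fact m / (\<Prod>i=1..d. w i)"
  \<comment> \<open>The Cauchy product for \<open>higher_bernoulli d n a w\<close> is integrated
    term by term in a. The term of degree d comes from i = d - 1, for which n - i = m.\<close>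
  define p where "p = (\<Sum>i\<le>n. monom (C * fps_nth (bernoulli_fps d w) (n - i) / fact (Suc i)) (Suc i))"
  have p0: "poly p 0 = 0" by (simp add: p_def poly_sum poly_monom)
  have p': "poly (pderiv p) a =
      fact m / (fact n * (\<Prod>i=1..d. w i)) * higher_bernoulli d n a w" for a
  proof -
    have "poly (pderiv p) a = (\<Sum>i\<le>n. C * (a ^ i / fact i * fps_nth (bernoulli_fps d w) (n - i)))"
      unfolding p_def higher_pderiv_sum[of 1, simplified] poly_sum
      by (intro sum.cong) (simp_all add: pderiv_monom poly_monom field_simps del: of_nat_Suc)
    then show ?thesis
      unfolding sum_distrib_left[symmetric] higher_bernoulli_eq_sum by (simp add: C_def)
  qed
  have "bernoullian_poly d m w = p"
    unfolding bernoullian_poly_def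
  proof (rule the_equality)
    fix q assume q: "poly q 0 = 0 \<and> (\<forall>a. poly (pderiv q) a =
      fact m / (fact (m + d - 1) * prod w {1..d}) * higher_bernoulli d (m + d - 1) a w)"
    then have "pderiv (q - p) = 0"
      unfolding pderiv_diff using p'
      by (simp add: n_def poly_eq_poly_eq_iff[symmetric] fun_eq_iff)
    then obtain h where h: "q - p = [:h:]" using pderiv_iszero by blast
    have "poly (q - p) 0 = 0" using q p0 by simp
    then show "q = p" using h by simp
  qed (use p0 p' in \<open>auto simp: n_def\<close>)
  then have "bernoullian_deriv0 d m w = pochhammer 1 d * poly.coeff p d"
    by (simp add: bernoullian_deriv0_def poly_0_coeff_0 coeff_higher_pderiv)
  also have "poly.coeff p d = (\<Sum>i\<le>n. if i = d - 1 then C * fps_nth (bernoulli_fps d w) (n - i) / fact (Suc i) else 0)"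
    unfolding p_def coeff_sum using assms by (intro sum.cong) auto
  also have "\<dots> = C * fps_nth (bernoulli_fps d w) m / fact d"
    using assms by (subst sum.delta) (auto simp: n_def)
  finally show ?thesis by (simp add: C_def pochhammer_fact[symmetric])
qed

subsection \<open>The half-plane and the difference equation\<close>

text \<open>The signed distance of z from the boundary line of the half-plane. It is real linear, so
  lattice points and corners can be bounded below term by term.\<close>

definition half_plane_coord :: "real \<Rightarrow> complex \<Rightarrow> real" where
  "half_plane_coord \<theta> z = Re (z * cis (- \<theta>))"

lemma half_plane_coord_add: "half_plane_coord \<theta> (x + y) = half_plane_coord \<theta> x + half_plane_coord \<theta> y"
  by (simp add: half_plane_coord_def algebra_simps)

lemma half_plane_coord_of_nat_mult:
  "half_plane_coord \<theta> (of_nat n * x) = of_nat n * half_plane_coord \<theta> x"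
  by (simp add: half_plane_coord_def algebra_simps)

lemma half_plane_coord_sum: "half_plane_coord \<theta> (sum f I) = (\<Sum>i\<in>I. half_plane_coord \<theta> (f i))"
  by (simp add: half_plane_coord_def sum_distrib_right)

lemma half_plane_coord_le_norm: "half_plane_coord \<theta> z \<le> norm z"
  unfolding half_plane_coord_def using complex_Re_le_cmod[of "z * cis (- \<theta>)"] by (simp add: norm_mult)

lemma half_plane_iff: "z \<in> half_plane \<theta> \<longleftrightarrow> half_plane_coord \<theta> z > 0"
proof
  assume "z \<in> half_plane \<theta>"
  then obtain \<phi> where z: "z \<noteq> 0" "is_Arg z \<phi>" "\<theta> - pi / 2 < \<phi>" "\<phi> < \<theta> + pi / 2"
    by (auto simp: half_plane_def)
  have "z * cis (- \<theta>) = of_real (norm z) * cis (\<phi> - \<theta>)"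
    using z(2) by (metis is_Arg_def cis_conv_exp cis_mult mult.assoc add_uminus_conv_diff)
  then have "half_plane_coord \<theta> z = norm z * cos (\<phi> - \<theta>)"
    by (simp add: half_plane_coord_def)
  moreover have "cos (\<phi> - \<theta>) > 0" using z by (intro cos_gt_zero_pi) auto
  ultimately show "half_plane_coord \<theta> z > 0" using z by simp
next
  assume pos: "half_plane_coord \<theta> z > 0"
  define u where "u = z * cis (- \<theta>)"
  have u: "Re u > 0" "u \<noteq> 0" using pos by (auto simp: u_def half_plane_coord_def)
  have "z = u * cis \<theta>" by (simp add: u_def mult.assoc cis_mult)
  also have "u = of_real (norm u) * cis (Im (Ln u))"
    using u by (metis Arg_def Arg_eq cis_conv_exp)
  finally have "z = of_real (norm z) * cis (Im (Ln u) + \<theta>)"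
    by (simp add: u_def norm_mult cis_mult mult.assoc)
  then have "is_Arg z (Im (Ln u) + \<theta>)" by (simp add: is_Arg_def cis_conv_exp)
  moreover have "\<bar>Im (Ln u)\<bar> < pi / 2" using u Re_Ln_pos_lt by blast
  ultimately show "z \<in> half_plane \<theta>"
    using u by (auto simp: half_plane_def u_def intro!: exI[of _ "Im (Ln u) + \<theta>"])
qed

lemma convex_half_plane_coord_ge: "convex {z. half_plane_coord \<theta> z \<ge> r}"
proof -
  have "{z. half_plane_coord \<theta> z \<ge> r} = {z. inner (cis \<theta>) z \<ge> r}"
    by (auto simp: half_plane_coord_def inner_complex_def algebra_simps)
  then show ?thesis by (simp add: convex_halfspace_ge)
qed

lemma convex_half_plane: "convex (half_plane \<theta>)"
proof -
  have "half_plane \<theta> = {z. inner (cis \<theta>) z > 0}"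
    by (auto simp: half_plane_iff half_plane_coord_def inner_complex_def algebra_simps)
  then show ?thesis by (simp add: convex_halfspace_gt)
qed

lemma open_half_plane: "open (half_plane \<theta>)"
proof -
  have "half_plane \<theta> = {z. inner (cis \<theta>) z > 0}"
    by (auto simp: half_plane_iff half_plane_coord_def inner_complex_def algebra_simps)
  then show ?thesis by (simp add: open_halfspace_gt)
qed

lemma log_branch_has_field_derivative:
  assumes "log_branch_on L (half_plane \<theta>)" "z \<in> half_plane \<theta>"
  shows "(L has_field_derivative inverse z) (at z)"
proof -
  have hol: "L holomorphic_on half_plane \<theta>" and ex: "exp (L y) = y" if "y \<in> half_plane \<theta>" for y
    using assms that by (auto simp: log_branch_on_def)
  obtain D where D: "(L has_field_derivative D) (at z)"
    using hol[OF assms(2)] open_half_plane assms(2)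
    by (meson holomorphic_on_imp_differentiable_at field_differentiable_def)
  have "((\<lambda>y. exp (L y)) has_field_derivative exp (L z) * D) (at z)"
    by (rule DERIV_fun_exp[OF D])
  moreover have "((\<lambda>y. exp (L y)) has_field_derivative 1) (at z)"
    by (rule has_field_derivative_transform_within_open[OF DERIV_ident open_half_plane assms(2)])
       (simp add: ex)
  ultimately have "exp (L z) * D = 1" by (rule DERIV_unique)
  then show ?thesis using D ex[OF assms(2)] by (simp add: inverse_unique)
qed

lemma Re_log_branch:
  assumes "log_branch_on L A" "z \<in> A"
  shows "Re (L z) = ln (norm z)"
  using assms by (metis log_branch_on_def norm_exp_eq_Re ln_exp)

text \<open>On the convex half-plane, L differs by a constant from the principal logarithm of the
  rotated variable, whose imaginary part is below pi/2 in modulus. With this bound, the modulus of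
  y^s is comparable to |y|^(Re s).\<close>

lemma log_branch_Im_bounded:
  assumes "log_branch_on L (half_plane \<theta>)"
  obtains B where "B \<ge> 0" "\<And>z. z \<in> half_plane \<theta> \<Longrightarrow> \<bar>Im (L z)\<bar> \<le> B"
proof -
  have "\<exists>c. \<forall>z\<in>half_plane \<theta>. L z - Ln (z * cis (- \<theta>)) = c"
  proof (rule has_field_derivative_zero_constant[OF convex_half_plane])
    fix z assume z: "z \<in> half_plane \<theta>"
    then have pos: "Re (z * cis (- \<theta>)) > 0" by (simp add: half_plane_iff half_plane_coord_def)
    then have "z * cis (- \<theta>) \<notin> \<real>\<^sub>\<le>\<^sub>0" "z \<noteq> 0"
      by (auto simp: complex_nonpos_Reals_iff)
    then have "((\<lambda>z. L z - Ln (z * cis (- \<theta>))) has_field_derivative 0) (at z)"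
      by (auto intro!: derivative_eq_intros log_branch_has_field_derivative[OF assms z] simp: field_simps)
    then show "((\<lambda>z. L z - Ln (z * cis (- \<theta>))) has_field_derivative 0) (at z within half_plane \<theta>)"
      by (rule has_field_derivative_at_within)
  qed
  then obtain c where c: "\<And>z. z \<in> half_plane \<theta> \<Longrightarrow> L z = Ln (z * cis (- \<theta>)) + c"
    by (metis diff_add_cancel add.commute)
  show ?thesis
  proof
    fix z assume z: "z \<in> half_plane \<theta>"
    then have pos: "Re (z * cis (- \<theta>)) > 0" by (simp add: half_plane_iff half_plane_coord_def)
    then have "\<bar>Im (Ln (z * cis (- \<theta>)))\<bar> < pi / 2"
      using Re_Ln_pos_lt by (metis zero_complex.sel(1) less_irrefl)
    then show "\<bar>Im (L z)\<bar> \<le> pi / 2 + \<bar>Im c\<bar>" using c[OF z] by simp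
  qed simp
qed

section \<open>Lower bounds on the lattice and the size of complex powers\<close>

locale barnes_data =
  fixes \<theta> :: real and L :: "complex \<Rightarrow> complex"
    and d :: nat and a :: complex and w :: "nat \<Rightarrow> complex"
  assumes branch: "log_branch_on L (half_plane \<theta>)"
    and d_pos: "d \<ge> 1"
    and a_in: "a \<in> half_plane \<theta>"
    and w_in: "i \<in> {1..d} \<Longrightarrow> w i \<in> half_plane \<theta>"
begin

abbreviation "\<rho> \<equiv> half_plane_coord \<theta>"

definition c0 :: real where "c0 = Min (insert (\<rho> a) ((\<lambda>i. \<rho> (w i)) ` {1..d}))"

lemma c0_pos: "c0 > 0"
  using a_in w_in unfolding c0_def half_plane_iff by (subst Min_gr_iff) auto

lemma c0_le_a: "c0 \<le> \<rho> a"
  unfolding c0_def by (rule Min_le) auto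

lemma c0_le_w: "i \<in> {1..d} \<Longrightarrow> c0 \<le> \<rho> (w i)"
  unfolding c0_def by (rule Min_le) auto

lemma w_nonzero: "i \<in> {1..d} \<Longrightarrow> w i \<noteq> 0"
  using w_in[of i] by (auto simp: half_plane_def)

text \<open>The scale of a lattice point: the summand 1 accounts for the shift by \<open>a\<close>
  and keeps the height away from 0.\<close>

definition height :: "(nat \<Rightarrow> nat) \<Rightarrow> real" where "height n = 1 + (\<Sum>i=1..d. real (n i))"

lemma height_ge_1: "height n \<ge> 1"
  by (simp add: height_def sum_nonneg)

lemma coord_lattice_ge: "\<rho> (a + multi_dot d n w) \<ge> c0 * height n"
proof -
  have "(\<Sum>i=1..d. real (n i) * c0) \<le> (\<Sum>i=1..d. real (n i) * \<rho> (w i))"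
    by (intro sum_mono mult_left_mono c0_le_w) auto
  then show ?thesis
    using c0_le_a by (simp add: height_def multi_dot_def half_plane_coord_add half_plane_coord_sum
        half_plane_coord_of_nat_mult distrib_left sum_distrib_left mult.commute[of c0])
qed

text \<open>One index in S already contributes at least M c0, and the others contribute nonnegative
  amounts. So every corner other than \<open>a\<close> moves to infinity linearly in M.\<close>

lemma coord_subset_sum_ge:
  assumes "S \<subseteq> {1..d}" "S \<noteq> {}"
  shows "\<rho> (a + (\<Sum>i\<in>S. of_nat M * w i)) \<ge> c0 * (1 + real M)"
proof -
  obtain j where j: "j \<in> S" using assms by auto
  have fin: "finite S" using assms finite_subset by auto
  have "real M * c0 \<le> real M * \<rho> (w j)"
    using assms j by (intro mult_left_mono c0_le_w) auto
  also have "\<dots> \<le> (\<Sum>i\<in>S. real M * \<rho> (w i))"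
  proof (rule member_le_sum[OF j _ fin])
    fix i assume "i \<in> S - {j}"
    then have "0 \<le> \<rho> (w i)" using c0_le_w[of i] c0_pos assms by force
    then show "0 \<le> real M * \<rho> (w i)" by simp
  qed
  finally show ?thesis
    using c0_le_a by (simp add: half_plane_coord_add half_plane_coord_sum
        half_plane_coord_of_nat_mult algebra_simps)
qed

text \<open>The modulus is exp(Re s ln|y| - Im s Im (L y)). As Re s is at most 0, the lower bound c0
  t for |y| controls the first term; the bounded argument controls the second. The constant K serves
  all s and y, which later gives uniformity in \<alpha>.\<close>

lemma norm_exp_log_le:
  obtains K where "K \<ge> 0" "\<And>A s b t y. Re s \<le> - b \<Longrightarrow> b \<ge> 0 \<Longrightarrow> norm s \<le> A \<Longrightarrow> t \<ge> 1 \<Longrightarrow> \<rho> y \<ge> c0 * t \<Longrightarrow>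
    norm (exp (s * L y)) \<le> exp (A * K) * t powr (- b)"
proof -
  obtain B where B: "B \<ge> 0" "\<And>z. z \<in> half_plane \<theta> \<Longrightarrow> \<bar>Im (L z)\<bar> \<le> B"
    using log_branch_Im_bounded[OF branch] by blast
  show ?thesis
  proof
    fix A b t :: real and s y :: complex
    assume as: "Re s \<le> - b" "b \<ge> 0" "norm s \<le> A" "t \<ge> 1" "\<rho> y \<ge> c0 * t"
    have pos: "c0 * t > 0" using c0_pos as by simp
    then have y: "y \<in> half_plane \<theta>" using as by (simp add: half_plane_iff)
    have "ln c0 + ln t = ln (c0 * t)" using c0_pos as by (simp add: ln_mult)
    also have "\<dots> \<le> ln (norm y)"
      using pos as half_plane_coord_le_norm[of \<theta> y] by (intro ln_mono) auto
    finally have le: "ln c0 + ln t \<le> ln (norm y)" .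
    have "Re s * ln (norm y) \<le> Re s * (ln c0 + ln t)"
      using le as by (intro mult_left_mono_neg) auto
    moreover have "Re s * ln c0 \<le> A * \<bar>ln c0\<bar>"
    proof -
      have "Re s * ln c0 \<le> \<bar>Re s\<bar> * \<bar>ln c0\<bar>" by (metis abs_ge_self abs_mult)
      also have "\<dots> \<le> A * \<bar>ln c0\<bar>"
        using as abs_Re_le_cmod[of s] by (intro mult_right_mono) auto
      finally show ?thesis .
    qed
    moreover have "Re s * ln t \<le> - b * ln t"
      using as by (intro mult_right_mono) auto
    moreover have "- (Im s * Im (L y)) \<le> A * B"
    proof -
      have "- (Im s * Im (L y)) \<le> \<bar>Im s\<bar> * \<bar>Im (L y)\<bar>" by (metis abs_ge_minus_self abs_mult)
      also have "\<dots> \<le> A * B"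
        using as abs_Im_le_cmod[of s] B(2)[OF y] by (intro mult_mono) auto
      finally show ?thesis .
    qed
    ultimately have "Re (s * L y) \<le> A * (B + \<bar>ln c0\<bar>) - b * ln t"
      using Re_log_branch[OF branch y] by (simp add: algebra_simps)
    then have "norm (exp (s * L y)) \<le> exp (A * (B + \<bar>ln c0\<bar>) - b * ln t)"
      by (simp add: norm_exp_eq_Re)
    also have "\<dots> = exp (A * (B + \<bar>ln c0\<bar>)) * t powr (- b)"
      using as by (simp add: powr_def flip: exp_add)
    finally show "norm (exp (s * L y)) \<le> exp (A * (B + \<bar>ln c0\<bar>)) * t powr (- b)" .
  qed (use B in auto)
qed

text \<open>
  Up to the factor \<open>\<Prod>\<^sub>k\<^sub>=\<^sub>1\<^sup>d (k - \<alpha>)\<close>, which cancels all poles in \<open>\<alpha>\<close>, this is the derivative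
  of order \<open>j - d\<close> of \<open>y \<mapsto> y\<^sup>-\<^sup>\<alpha>\<close>, negative orders being antiderivatives.
\<close>
definition kernel :: "nat \<Rightarrow> complex \<Rightarrow> complex \<Rightarrow> complex" where
  "kernel j \<alpha> y = (\<Prod>i<j. of_nat d - of_nat i - \<alpha>) * exp ((of_nat d - of_nat j - \<alpha>) * L y)"

text \<open>Differentiation lowers the exponent by one and brings out exactly the next factor of the
  product, so the kernels form a chain of successive derivatives.\<close>

lemma kernel_has_field_derivative:
  assumes "y \<in> half_plane \<theta>"
  shows "(kernel j \<alpha> has_field_derivative kernel (Suc j) \<alpha> y) (at y)"
proof -
  have y: "y \<noteq> 0" "exp (L y) = y" using assms branch by (auto simp: half_plane_def log_branch_on_def)
  have "exp ((of_nat d - of_nat (Suc j) - \<alpha>) * L y) = exp ((of_nat d - of_nat j - \<alpha>) * L y - L y)"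
    by (simp add: algebra_simps)
  also have "\<dots> = exp ((of_nat d - of_nat j - \<alpha>) * L y) * inverse y"
    using y by (simp add: exp_diff divide_inverse)
  finally have e: "exp ((of_nat d - of_nat (Suc j) - \<alpha>) * L y) =
      exp ((of_nat d - of_nat j - \<alpha>) * L y) * inverse y" .
  show ?thesis
    unfolding kernel_def e
    by (rule derivative_eq_intros log_branch_has_field_derivative[OF branch assms] refl)+
       (simp add: mult_ac)
qed

text \<open>These are the coefficients b_m of the product of the z / (e^(w_i z) - 1), that is,
  B_m(0|w) / (m! w_1 ... w_d).\<close>

definition coef :: "nat \<Rightarrow> complex" where
  "coef m = fps_nth (bernoulli_fps d w) m / (\<Prod>i=1..d. w i)"

text \<open>The inverse of the difference operator, cut off at order N and applied to y^(-\<alpha>);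
  the common factor in the kernels removes the poles in \<alpha>.\<close>

definition primitive :: "nat \<Rightarrow> complex \<Rightarrow> complex \<Rightarrow> complex" where
  "primitive N \<alpha> y = (\<Sum>m\<le>N. coef m * kernel m \<alpha> y)"

definition remainder :: "nat \<Rightarrow> complex \<Rightarrow> complex \<Rightarrow> complex" where
  "remainder N \<alpha> x = iterated_diff {1..d} w (primitive N \<alpha>) x - kernel d \<alpha> x"

lemma iterated_diff_power_w:
  "iterated_diff {1..d} w (\<lambda>y. y ^ i) 0 = fact i * fps_nth (\<Prod>i=1..d. fps_exp (w i) - 1) i"
  by (simp add: iterated_diff_power)

text \<open>Coefficientwise, the Bernoulli series divided by the product of the w_i, times the
  product of the e^(w_i z) - 1, is z^d.\<close>

lemma coef_convolution:
  "(\<Sum>m\<le>p. coef m * fps_nth (\<Prod>i=1..d. fps_exp (w i) - 1) (p - m)) = (if p = d then 1 else 0)"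
proof -
  have nz: "(\<Prod>i=1..d. w i) \<noteq> 0" using w_nonzero by auto
  have "(\<Sum>m\<le>p. coef m * fps_nth (\<Prod>i=1..d. fps_exp (w i) - 1) (p - m)) =
      fps_nth (bernoulli_fps d w * (\<Prod>i=1..d. fps_exp (w i) - 1)) p / (\<Prod>i=1..d. w i)"
    by (simp add: fps_mult_nth coef_def sum_divide_distrib atMost_atLeast0)
  then show ?thesis
    using nz by (simp only: bernoulli_fps_times[of d w, OF w_nonzero]) (simp add: fps_X_power_nth)
qed

text \<open>The Bernoulli coefficients are those of the inverse of the difference operator, so the
  Taylor polynomials recombine to the kernel itself.\<close>
lemma iterated_diff_taylor_polynomial:
  "(\<Sum>m\<le>N. coef m * (\<Sum>i\<le>N + d - m. G (m + i) / fact i * iterated_diff {1..d} w (\<lambda>y. y ^ i) 0)) = G d"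
proof -
  define E where "E = (\<Prod>i=1..d. fps_exp (w i) - 1)"
  have E0: "fps_nth E i = 0" if "i < d" for i
    using that by (simp add: E_def prod_fps_exp_minus_1 fps_X_power_mult_nth)
  define h where "h m i = coef m * fps_nth E i * G (m + i)" for m i
  have "(\<Sum>m\<le>N. coef m * (\<Sum>i\<le>N + d - m. G (m + i) / fact i * iterated_diff {1..d} w (\<lambda>y. y ^ i) 0)) =
      (\<Sum>m\<le>N. \<Sum>i\<le>N + d - m. h m i)"
    unfolding iterated_diff_power_w E_def[symmetric] h_def sum_distrib_left by (simp add: mult_ac)
  \<comment> \<open>For m > N the inner index satisfies i < d, where E has no coefficients. The full
    triangle m + i \<le> N + d can thus be summed along its diagonals.\<close>
  also have "\<dots> = (\<Sum>m\<le>N + d. \<Sum>i\<le>N + d - m. h m i)"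
    by (rule sum.mono_neutral_left) (auto simp: h_def E0 intro!: sum.neutral)
  also have "\<dots> = (\<Sum>(m, i)\<in>{(m, i). m + i \<le> N + d}. h m i)"
    by (subst sum.Sigma) (auto intro!: sum.cong)
  also have "\<dots> = (\<Sum>p\<le>N + d. \<Sum>m\<le>p. h m (p - m))"
    by (rule sum.triangle_reindex_eq)
  also have "\<dots> = (\<Sum>p\<le>N + d. (\<Sum>m\<le>p. coef m * fps_nth E (p - m)) * G p)"
    by (simp add: h_def sum_distrib_right)
  also have "\<dots> = (\<Sum>p\<le>N + d. if p = d then G p else 0)"
    unfolding E_def coef_convolution by (intro sum.cong) auto
  also have "\<dots> = G d" by (subst sum.delta) auto
  finally show ?thesis .
qed

text \<open>The expansion stops at total order K, whatever m is, so the error always involves the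
  same derivative \<open>kernel (Suc K)\<close>. The segment from x to x + v stays in the convex set
  \<rho> y \<ge> r, where that derivative is bounded.\<close>

lemma kernel_taylor:
  assumes r: "r > 0" "\<rho> x \<ge> r" "\<rho> v \<ge> 0" and m: "m \<le> K"
    and B: "\<And>y. \<rho> y \<ge> r \<Longrightarrow> norm (kernel (Suc K) \<alpha> y) \<le> B"
  shows "norm (kernel m \<alpha> (x + v) - (\<Sum>i\<le>K - m. kernel (m + i) \<alpha> x / fact i * v ^ i))
           \<le> B * (norm v ^ Suc (K - m) / fact (K - m))"
proof -
  have "norm (kernel (m + 0) \<alpha> (x + v) -
      (\<Sum>i\<le>K - m. kernel (m + i) \<alpha> x * (x + v - x) ^ i / fact i))
    \<le> B * norm (x + v - x) ^ Suc (K - m) / fact (K - m)"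
  proof (rule complex_Taylor[where f = "\<lambda>i. kernel (m + i) \<alpha>", OF convex_half_plane_coord_ge[of r \<theta>]])
    fix i y assume "y \<in> {z. r \<le> \<rho> z}" "i \<le> K - m"
    then have "y \<in> half_plane \<theta>" using r by (simp add: half_plane_iff)
    then show "(kernel (m + i) \<alpha> has_field_derivative kernel (m + Suc i) \<alpha> y) (at y within {z. r \<le> \<rho> z})"
      using kernel_has_field_derivative has_field_derivative_at_within by (metis add_Suc_right)
  qed (use r m B in \<open>auto simp: half_plane_coord_add\<close>)
  then show ?thesis by (simp add: mult_ac)
qed

text \<open>The Taylor polynomials of total order N + d reproduce \<open>kernel d\<close> exactly,
  so only Taylor errors survive. The constant C is chosen before \<alpha>, x, r and B.\<close>

lemma remainder_le:
  obtains C where "C \<ge> 0"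
    "\<And>\<alpha> x r B. r > 0 \<Longrightarrow> \<rho> x \<ge> r \<Longrightarrow> (\<And>y. \<rho> y \<ge> r \<Longrightarrow> norm (kernel (Suc (N + d)) \<alpha> y) \<le> B) \<Longrightarrow>
       norm (remainder N \<alpha> x) \<le> B * C"
proof -
  define e where "e m S = norm (sum w S) ^ Suc (N + d - m) / fact (N + d - m)" for m S
  define C where "C = (\<Sum>S\<in>Pow {1..d}. \<Sum>m\<le>N. norm (coef m) * e m S)"
  have e0: "e m S \<ge> 0" for m S by (simp add: e_def)
  show ?thesis
  proof
    show "C \<ge> 0" unfolding C_def using e0 by (intro sum_nonneg mult_nonneg_nonneg) auto
  next
    fix \<alpha> x and r B :: real
    assume r: "r > 0" "\<rho> x \<ge> r" and B: "\<And>y. \<rho> y \<ge> r \<Longrightarrow> norm (kernel (Suc (N + d)) \<alpha> y) \<le> B"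
    define T where "T m v = (\<Sum>i\<le>N + d - m. kernel (m + i) \<alpha> x / fact i * v ^ i)" for m v
    have "kernel d \<alpha> x = (\<Sum>m\<le>N. coef m * iterated_diff {1..d} w (T m) 0)"
      unfolding T_def iterated_diff_linear_combination
      by (rule iterated_diff_taylor_polynomial[of "\<lambda>j. kernel j \<alpha> x", symmetric])
    also have "\<dots> = (\<Sum>S\<in>Pow {1..d}. (-1) ^ card ({1..d} - S) * (\<Sum>m\<le>N. coef m * T m (sum w S)))"
      unfolding iterated_diff_linear_combination[symmetric] by (simp add: iterated_diff_def)
    finally have "remainder N \<alpha> x = (\<Sum>S\<in>Pow {1..d}. (-1) ^ card ({1..d} - S) *
        (\<Sum>m\<le>N. coef m * (kernel m \<alpha> (x + sum w S) - T m (sum w S))))"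
      by (simp add: remainder_def iterated_diff_def primitive_def sum_subtractf right_diff_distrib)
    also have "norm \<dots> \<le> (\<Sum>S\<in>Pow {1..d}. \<Sum>m\<le>N. norm (coef m) * (B * e m S))"
    proof (intro sum_norm_le)
      fix S assume S: "S \<in> Pow {1..d}"
      have v: "\<rho> (sum w S) \<ge> 0"
        unfolding half_plane_coord_sum using S c0_le_w c0_pos by (intro sum_nonneg) force
      have "norm ((-1) ^ card ({1..d} - S) * (\<Sum>m\<le>N. coef m * (kernel m \<alpha> (x + sum w S) - T m (sum w S)))) =
          norm (\<Sum>m\<le>N. coef m * (kernel m \<alpha> (x + sum w S) - T m (sum w S)))"
        by (simp add: norm_mult norm_power)
      also have "\<dots> \<le> (\<Sum>m\<le>N. norm (coef m) * (B * e m S))"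
        unfolding e_def T_def norm_mult
        by (intro sum_norm_le, unfold norm_mult, intro mult_left_mono kernel_taylor[OF r v _ B]) auto
      finally show "norm ((-1) ^ card ({1..d} - S) * (\<Sum>m\<le>N. coef m * (kernel m \<alpha> (x + sum w S) - T m (sum w S))))
          \<le> (\<Sum>m\<le>N. norm (coef m) * (B * e m S))" .
    qed
    also have "\<dots> = B * C" by (simp add: C_def sum_distrib_left mult_ac)
    finally show "norm (remainder N \<alpha> x) \<le> B * C" .
  qed
qed

end

subsection \<open>Convergence of the remainder series\<close>

text \<open>The height t dominates every 1 + n_i. Splitting the exponent b evenly bounds t^(-b) by a
  product of terms (1 + n_i)^(-p) with p = b / |I| > 1, a product of convergent one-dimensional
  series.\<close>

lemma summable_on_height_powr:
  fixes I :: "'i set"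
  assumes I: "finite I" "I \<noteq> {}" and b: "b > real (card I)"
  shows "(\<lambda>n. (1 + (\<Sum>i\<in>I. real (n i))) powr (- b)) summable_on (I \<rightarrow>\<^sub>E (UNIV :: nat set))"
proof -
  define p where "p = b / real (card I)"
  have card: "card I > 0" using I by (simp add: card_gt_0_iff)
  have p: "p > 1" using b card by (simp add: p_def field_simps)
  have "summable (\<lambda>n. real (Suc n) powr (- p))"
    using p summable_Suc_iff[of "\<lambda>n. real n powr (- p)"] by (simp only: summable_real_powr_iff)
  then have "Infinite_Set_Sum.abs_summable_on (\<lambda>n. real (Suc n) powr (- p)) UNIV"
    by (simp add: abs_summable_on_nat_iff')
  then have "Infinite_Set_Sum.abs_summable_on (\<lambda>n. \<Prod>i\<in>I. real (Suc (n i)) powr (- p)) (I \<rightarrow>\<^sub>E UNIV)"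
    using I by (intro abs_summable_on_prod_PiE) auto
  then have sm: "(\<lambda>n. \<Prod>i\<in>I. real (Suc (n i)) powr (- p)) summable_on (I \<rightarrow>\<^sub>E UNIV)"
    unfolding abs_summable_equivalent[symmetric] by (rule abs_summable_summable)
  show ?thesis
  proof (rule summable_on_comparison_test[OF sm])
    fix n :: "'i \<Rightarrow> nat"
    define t where "t = 1 + (\<Sum>i\<in>I. real (n i))"
    have t: "t \<ge> 1" by (simp add: t_def sum_nonneg)
    have "real (n i) \<le> (\<Sum>i\<in>I. real (n i))" if "i \<in> I" for i
      using that I by (intro member_le_sum) auto
    then have le: "real (Suc (n i)) \<le> t" if "i \<in> I" for i
      using that unfolding t_def by force
    have "- b = - p * real (card I)" using card by (simp add: p_def)
    then have "t powr (- b) = (t powr (- p)) powr real (card I)" by (simp only: powr_powr)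
    also have "\<dots> = (t powr (- p)) ^ card I" using t by (intro powr_realpow) simp
    also have "\<dots> = (\<Prod>i\<in>I. t powr (- p))" by simp
    also have "\<dots> \<le> (\<Prod>i\<in>I. real (Suc (n i)) powr (- p))"
      using le p by (intro prod_mono conjI powr_mono2') auto
    finally show "(1 + (\<Sum>i\<in>I. real (n i))) powr (- b) \<le> (\<Prod>i\<in>I. real (Suc (n i)) powr (- p))"
      by (simp add: t_def)
  qed auto
qed

text \<open>Any finite set of multi-indices fits into a large cube; this turns unordered sums into
  limits along cubes.\<close>

lemma filterlim_cube_finite_subsets:
  assumes "finite I"
  shows "filterlim (\<lambda>M. I \<rightarrow>\<^sub>E {..<M}) (finite_subsets_at_top (I \<rightarrow>\<^sub>E (UNIV :: nat set))) sequentially"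
  unfolding filterlim_finite_subsets_at_top
proof (intro allI impI)
  fix X :: "('a \<Rightarrow> nat) set" assume X: "finite X \<and> X \<subseteq> I \<rightarrow>\<^sub>E UNIV"
  define b where "b = Max (insert 0 ((\<lambda>(n, i). n i) ` (X \<times> I)))"
  have b: "n i \<le> b" if "n \<in> X" "i \<in> I" for n i
    unfolding b_def using X assms that by (intro Max_ge) force+
  show "\<forall>\<^sub>F M in sequentially. finite (I \<rightarrow>\<^sub>E {..<M}) \<and> X \<subseteq> I \<rightarrow>\<^sub>E {..<M} \<and> I \<rightarrow>\<^sub>E {..<M} \<subseteq> I \<rightarrow>\<^sub>E UNIV"
    using eventually_gt_at_top[of b]
  proof eventually_elim
    case (elim M)
    have "X \<subseteq> I \<rightarrow>\<^sub>E {..<M}"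
    proof
      fix n assume n: "n \<in> X"
      then show "n \<in> I \<rightarrow>\<^sub>E {..<M}"
        using X b[OF n] elim by (force simp: PiE_iff)
    qed
    then show ?case using assms by (auto intro!: finite_PiE)
  qed
qed

text \<open>The identity theorem makes the difference vanish on punctured neighbourhoods. The
  normalisation at poles and removable singularities then determines the remaining values.\<close>

lemma nicely_meromorphic_on_unique:
  assumes f: "f nicely_meromorphic_on UNIV" and g: "g nicely_meromorphic_on UNIV"
    and A: "open A" "z0 \<in> A" "\<And>z. z \<in> A \<Longrightarrow> f z = g z"
  shows "f = g"
proof
  fix z
  define h where "h = (\<lambda>z. f z - g z)"
  have mero: "f meromorphic_on UNIV" "g meromorphic_on UNIV"
    using f g by (auto simp: nicely_meromorphic_on_def)
  then have h: "h meromorphic_on UNIV" unfolding h_def by (intro meromorphic_intros)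
  have "\<forall>\<^sub>F y in at z0. remove_sings h y = 0"
  proof -
    have "\<forall>\<^sub>F y in at z0. remove_sings h y = h y"
      using h by (intro eventually_remove_sings_eq_at) (auto intro: meromorphic_on_isolated_singularity meromorphic_on_subset)
    moreover have "\<forall>\<^sub>F y in at z0. y \<in> A"
      using A by (simp add: eventually_at_in_open')
    ultimately show ?thesis by eventually_elim (use A in \<open>auto simp: h_def\<close>)
  qed
  then have "\<exists>\<^sub>F y in at z0. remove_sings h y = 0"
    by (intro eventually_frequently) auto
  then have zero: "remove_sings h y = 0" for y
    by (rule frequently_eq_meromorphic_imp_constant[OF _ remove_sings_nicely_meromorphic[OF h]]) auto
  have nice: "remove_sings k z = k z" if "k nicely_meromorphic_on UNIV" for k
    using that unfolding nicely_meromorphic_on_def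
    by (metis UNIV_I remove_sings_at_pole remove_sings_eqI)
  have "\<forall>\<^sub>F y in at z. remove_sings h y = h y"
    using h by (intro eventually_remove_sings_eq_at) (auto intro: meromorphic_on_isolated_singularity meromorphic_on_subset)
  then have "\<forall>\<^sub>F y in at z. h y = 0"
    by eventually_elim (simp add: zero)
  then have "\<forall>\<^sub>F y in at z. f y = g y"
    by eventually_elim (simp add: h_def)
  then have "remove_sings f z = remove_sings g z" by (rule remove_sings_cong) simp
  then show "f z = g z" using nice f g by simp
qed

section \<open>Approximants and their locally uniform limit\<close>

context barnes_data
begin

abbreviation "lattice \<equiv> {1..d} \<rightarrow>\<^sub>E (UNIV :: nat set)"
abbreviation "cube M \<equiv> {1..d} \<rightarrow>\<^sub>E {..<M}"

lemma summable_on_height: "b > real d \<Longrightarrow> (\<lambda>n. height n powr (- b)) summable_on lattice"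
  using summable_on_height_powr[of "{1..d}" b] d_pos unfolding height_def by simp

lemma remainder_le_summable:
  assumes "Re \<alpha>0 > real d - real N - 1"
  obtains r C b where "r > 0" "b > real d"
    "cball \<alpha>0 r \<subseteq> {\<alpha>. Re \<alpha> > real d - real N - 1}"
    "\<And>\<alpha> n. \<alpha> \<in> cball \<alpha>0 r \<Longrightarrow> norm (remainder N \<alpha> (a + multi_dot d n w)) \<le> C * height n powr (- b)"
proof -
  \<comment> \<open>Half the distance from \<alpha>0 to the boundary of the half-plane of
    convergence: on the ball, Re \<alpha> + N + 1 \<ge> d + r, so b = d + r is a summable exponent.
    Below, A bounds |\<alpha>| and P the product in \<open>kernel (Suc (N + d))\<close>.\<close>
  define r where "r = (Re \<alpha>0 - (real d - real N - 1)) / 2"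
  have r: "r > 0" using assms by (simp add: r_def)
  define A where "A = norm \<alpha>0 + r"
  define P where "P = (\<Prod>i<Suc (N + d). real d + real i + A)"
  obtain K where K: "\<And>A s b t y. Re s \<le> - b \<Longrightarrow> b \<ge> 0 \<Longrightarrow> norm s \<le> A \<Longrightarrow> t \<ge> 1 \<Longrightarrow> \<rho> y \<ge> c0 * t \<Longrightarrow>
    norm (exp (s * L y)) \<le> exp (A * K) * t powr (- b)" using norm_exp_log_le by metis
  have A: "A \<ge> 0" using r by (simp add: A_def)
  then have P: "P \<ge> 0" unfolding P_def by (intro prod_nonneg) auto
  obtain C where C: "C \<ge> 0" "\<And>\<alpha> x r B. r > 0 \<Longrightarrow> \<rho> x \<ge> r \<Longrightarrow> (\<And>y. \<rho> y \<ge> r \<Longrightarrow> norm (kernel (Suc (N + d)) \<alpha> y) \<le> B) \<Longrightarrow>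
       norm (remainder N \<alpha> x) \<le> B * C" using remainder_le[of N] by metis
  define Q where "Q = P * exp ((N + 1 + A) * K)"
  have near: "norm \<alpha> \<le> A" "Re \<alpha> \<ge> Re \<alpha>0 - r" if "\<alpha> \<in> cball \<alpha>0 r" for \<alpha>
  proof -
    have "norm (\<alpha>0 - \<alpha>) \<le> r" using that by (simp add: dist_norm)
    then show "norm \<alpha> \<le> A" "Re \<alpha> \<ge> Re \<alpha>0 - r"
      using norm_triangle_ineq3[of \<alpha> \<alpha>0] abs_Re_le_cmod[of "\<alpha>0 - \<alpha>"]
      by (auto simp: A_def norm_minus_commute)
  qed
  show ?thesis
  proof
    show "r > 0" by (fact r)
    show "real d + r > real d" using r by simp
    show "cball \<alpha>0 r \<subseteq> {\<alpha>. Re \<alpha> > real d - real N - 1}"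
      using near(2) r unfolding r_def by (force simp: field_simps)
    fix \<alpha> n assume al: "\<alpha> \<in> cball \<alpha>0 r"
    have "norm (remainder N \<alpha> (a + multi_dot d n w)) \<le> Q * height n powr (- (real d + r)) * C"
    proof (rule C(2))
      show "c0 * height n > 0" using c0_pos height_ge_1[of n] by simp
      show "\<rho> (a + multi_dot d n w) \<ge> c0 * height n" by (rule coord_lattice_ge)
      fix y assume y: "\<rho> y \<ge> c0 * height n"
      have "norm (\<Prod>i<Suc (N + d). of_nat d - of_nat i - \<alpha>) \<le> P"
        unfolding P_def prod_norm[symmetric]
      proof (intro prod_mono conjI)
        fix i
        have "norm (of_nat d - of_nat i - \<alpha>) \<le> norm (of_nat d :: complex) + norm (of_nat i :: complex) + norm \<alpha>"
          by (intro norm_triangle_le_diff order.refl add_right_mono)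
        then show "norm (of_nat d - of_nat i - \<alpha>) \<le> real d + real i + A"
          using near(1)[OF al] by simp
      qed auto
      moreover have "norm (exp ((of_nat d - of_nat (Suc (N + d)) - \<alpha>) * L y)) \<le>
          exp ((N + 1 + A) * K) * height n powr (- (real d + r))"
      proof (rule K)
        show "Re (of_nat d - of_nat (Suc (N + d)) - \<alpha>) \<le> - (real d + r)"
          using near(2)[OF al] by (simp add: r_def field_simps)
        have "norm (of_nat d - of_nat (Suc (N + d)) - \<alpha>) = norm (of_nat (N + 1) + \<alpha>)"
          by (subst norm_minus_cancel[symmetric]) (simp add: algebra_simps)
        also have "\<dots> \<le> real (N + 1) + norm \<alpha>"
          by (metis norm_triangle_ineq norm_of_nat)
        finally show "norm (of_nat d - of_nat (Suc (N + d)) - \<alpha>) \<le> N + 1 + A"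
          using near(1)[OF al] by simp
      qed (use r y height_ge_1 in auto)
      ultimately show "norm (kernel (Suc (N + d)) \<alpha> y) \<le> Q * height n powr (- (real d + r))"
        unfolding kernel_def norm_mult Q_def mult.assoc
        using P by (intro mult_mono) auto
    qed
    then show "norm (remainder N \<alpha> (a + multi_dot d n w)) \<le> (Q * C) * height n powr (- (real d + r))"
      by (simp add: mult_ac)
  qed
qed

text \<open>This will be \<open>pole_factor\<close> times the zeta function. The first term is the
  contribution of the fixed corner \<open>a\<close>, the only one that does not vanish in the limit
  when Re \<alpha> > d.\<close>

definition continuation :: "nat \<Rightarrow> complex \<Rightarrow> complex" where
  "continuation N \<alpha> = (-1) ^ d * primitive N \<alpha> a - (\<Sum>\<^sub>\<infinity>n\<in>lattice. remainder N \<alpha> (a + multi_dot d n w))"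

definition approximant :: "nat \<Rightarrow> nat \<Rightarrow> complex \<Rightarrow> complex" where
  "approximant N M \<alpha> = (-1) ^ d * primitive N \<alpha> a - (\<Sum>n\<in>cube M. remainder N \<alpha> (a + multi_dot d n w))"

text \<open>The Weierstrass test applies with a power of the height as majorant. Uniformity lets
  holomorphy and derivatives in \<alpha> pass to the limit.\<close>

lemma uniform_limit_approximant:
  assumes "Re \<alpha>0 > real d - real N - 1"
  shows "\<exists>r>0. cball \<alpha>0 r \<subseteq> {\<alpha>. Re \<alpha> > real d - real N - 1} \<and>
    uniform_limit (cball \<alpha>0 r) (approximant N) (continuation N) sequentially"
proof -
  obtain r C b where r: "r > 0" "b > real d" "cball \<alpha>0 r \<subseteq> {\<alpha>. Re \<alpha> > real d - real N - 1}"
    and le: "\<And>\<alpha> n. \<alpha> \<in> cball \<alpha>0 r \<Longrightarrow> norm (remainder N \<alpha> (a + multi_dot d n w)) \<le> C * height n powr (- b)"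
    using remainder_le_summable[OF assms] by metis
  have "uniform_limit (cball \<alpha>0 r) (\<lambda>X \<alpha>. \<Sum>n\<in>X. remainder N \<alpha> (a + multi_dot d n w))
      (\<lambda>\<alpha>. \<Sum>\<^sub>\<infinity>n\<in>lattice. remainder N \<alpha> (a + multi_dot d n w)) (finite_subsets_at_top lattice)"
    by (rule Weierstrass_m_test_general[OF le summable_on_cmult_right[OF summable_on_height[OF r(2)]]])
  then have "uniform_limit (cball \<alpha>0 r) (\<lambda>M \<alpha>. \<Sum>n\<in>cube M. remainder N \<alpha> (a + multi_dot d n w))
      (\<lambda>\<alpha>. \<Sum>\<^sub>\<infinity>n\<in>lattice. remainder N \<alpha> (a + multi_dot d n w)) sequentially"
    by (rule filterlim_compose) (rule filterlim_cube_finite_subsets, simp)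
  then have "uniform_limit (cball \<alpha>0 r) (approximant N) (continuation N) sequentially"
    unfolding approximant_def continuation_def
    by (intro uniform_limit_minus uniform_limit_const)
  then show ?thesis using r by blast
qed

lemma kernel_holomorphic: "(\<lambda>\<alpha>. kernel j \<alpha> y) holomorphic_on A"
  unfolding kernel_def by (intro holomorphic_intros)

lemma primitive_holomorphic: "(\<lambda>\<alpha>. primitive N \<alpha> y) holomorphic_on A"
  unfolding primitive_def by (intro holomorphic_intros kernel_holomorphic)

lemma remainder_holomorphic: "(\<lambda>\<alpha>. remainder N \<alpha> y) holomorphic_on A"
  unfolding remainder_def iterated_diff_def
  by (intro holomorphic_on_diff holomorphic_on_sum holomorphic_on_mult holomorphic_on_const
      kernel_holomorphic primitive_holomorphic)

lemma approximant_holomorphic: "approximant N M holomorphic_on A"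
  unfolding approximant_def by (intro holomorphic_on_diff holomorphic_on_sum holomorphic_on_mult holomorphic_on_const
      remainder_holomorphic primitive_holomorphic)

lemma open_Re_gt: "open {\<alpha>. Re \<alpha> > x}"
  by (simp add: open_halfspace_Re_gt)

lemma continuation_holomorphic: "continuation N holomorphic_on {\<alpha>. Re \<alpha> > real d - real N - 1}"
proof (rule holomorphic_uniform_sequence[where f = "approximant N"])
  show "\<exists>r>0. cball \<alpha>0 r \<subseteq> {\<alpha>. Re \<alpha> > real d - real N - 1} \<and>
      uniform_limit (cball \<alpha>0 r) (approximant N) (continuation N) sequentially"
    if "\<alpha>0 \<in> {\<alpha>. Re \<alpha> > real d - real N - 1}" for \<alpha>0
    using that by (intro uniform_limit_approximant) simp
qed (rule open_Re_gt approximant_holomorphic)+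

lemma approximant_tendsto:
  assumes "Re \<alpha> > real d - real N - 1"
  shows "(\<lambda>M. approximant N M \<alpha>) \<longlonglongrightarrow> continuation N \<alpha>"
proof -
  obtain r where "r > 0" "uniform_limit (cball \<alpha> r) (approximant N) (continuation N) sequentially"
    using uniform_limit_approximant[OF assms] by blast
  then show ?thesis by (intro tendsto_uniform_limitI) auto
qed

text \<open>The summed differences telescope to the corners; the corner \<open>a\<close>, from the
  empty subset, cancels the first term of \<open>approximant\<close>, leaving exactly the nonempty
  subsets.\<close>

lemma approximant_eq:
  "approximant N M \<alpha> = (\<Sum>n\<in>cube M. kernel d \<alpha> (a + multi_dot d n w)) -
     alt_subset_sum d (\<lambda>x. primitive N \<alpha> (a + x)) (\<lambda>i. of_nat M * w i)"
proof -
  let ?D = "iterated_diff {1..d} (\<lambda>i. of_nat M * w i) (primitive N \<alpha>) a"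
  have E: "(\<Sum>n\<in>cube M. remainder N \<alpha> (a + multi_dot d n w)) =
      ?D - (\<Sum>n\<in>cube M. kernel d \<alpha> (a + multi_dot d n w))"
    unfolding remainder_def sum_subtractf multi_dot_def
    by (subst sum_iterated_diff_cube) auto
  show ?thesis unfolding approximant_def E iterated_diff_eq_alt_subset_sum by simp
qed

definition pole_factor :: "complex \<Rightarrow> complex" where
  "pole_factor \<alpha> = (\<Prod>i<d. of_nat d - of_nat i - \<alpha>)"

lemma kernel_d: "kernel d \<alpha> y = pole_factor \<alpha> * branch_power L y (- \<alpha>)"
  by (simp add: kernel_def pole_factor_def branch_power_def)

lemma summable_on_branch_power:
  assumes "Re \<alpha> > real d"
  shows "(\<lambda>n. branch_power L (a + multi_dot d n w) (- \<alpha>)) summable_on lattice"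
proof -
  obtain K where K: "\<And>A s b t y. Re s \<le> - b \<Longrightarrow> b \<ge> 0 \<Longrightarrow> norm s \<le> A \<Longrightarrow> t \<ge> 1 \<Longrightarrow> \<rho> y \<ge> c0 * t \<Longrightarrow>
    norm (exp (s * L y)) \<le> exp (A * K) * t powr (- b)" using norm_exp_log_le by metis
  have "norm (branch_power L (a + multi_dot d n w) (- \<alpha>)) \<le>
      exp (norm \<alpha> * K) * height n powr (- Re \<alpha>)" for n
    unfolding branch_power_def
    by (rule K) (use assms height_ge_1 coord_lattice_ge in auto)
  then have "(\<lambda>n. norm (branch_power L (a + multi_dot d n w) (- \<alpha>))) summable_on lattice"
    by (rule Infinite_Sum.abs_summable_on_comparison_test'[OF
          summable_on_cmult_right[OF summable_on_height[OF assms]]])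
  then show ?thesis by (rule abs_summable_summable)
qed

lemma kernel_tendsto_0:
  assumes S: "S \<subseteq> {1..d}" "S \<noteq> {}" and \<alpha>: "Re \<alpha> > real d"
  shows "(\<lambda>M. kernel j \<alpha> (a + (\<Sum>i\<in>S. of_nat M * w i))) \<longlonglongrightarrow> 0"
proof -
  obtain K where K: "\<And>A s b t y. Re s \<le> - b \<Longrightarrow> b \<ge> 0 \<Longrightarrow> norm s \<le> A \<Longrightarrow> t \<ge> 1 \<Longrightarrow> \<rho> y \<ge> c0 * t \<Longrightarrow>
    norm (exp (s * L y)) \<le> exp (A * K) * t powr (- b)" using norm_exp_log_le by metis
  define s where "s = of_nat d - of_nat j - \<alpha>"
  have "norm (exp (s * L (a + (\<Sum>i\<in>S. of_nat M * w i)))) \<le>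
      exp (norm s * K) * (1 + real M) powr (- (Re \<alpha> - real d))" for M
    by (rule K) (use \<alpha> coord_subset_sum_ge[OF S, of M] in \<open>auto simp: s_def\<close>)
  moreover have "(\<lambda>M. (1 + real M) powr (- (Re \<alpha> - real d))) \<longlonglongrightarrow> 0"
    using \<alpha> by (intro tendsto_neg_powr) (auto intro!: filterlim_tendsto_add_at_top filterlim_real_sequentially)
  then have "(\<lambda>M. exp (norm s * K) * (1 + real M) powr (- (Re \<alpha> - real d))) \<longlonglongrightarrow> 0"
    by (rule tendsto_mult_right_zero)
  ultimately have "(\<lambda>M. exp (s * L (a + (\<Sum>i\<in>S. of_nat M * w i)))) \<longlonglongrightarrow> 0"
    by (rule Lim_null_comparison[OF always_eventually[OF allI]])
  then show ?thesis
    unfolding kernel_def s_def by (rule tendsto_mult_right_zero)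
qed

text \<open>For Re \<alpha> > d all kernels in \<open>primitive\<close> have exponents of negative
  real part, so the moving corners contribute 0 in the limit and only the Dirichlet-type series
  remains.\<close>

lemma continuation_eq_series:
  assumes \<alpha>: "Re \<alpha> > real d"
  shows "continuation N \<alpha> = pole_factor \<alpha> * (\<Sum>\<^sub>\<infinity>n\<in>lattice. branch_power L (a + multi_dot d n w) (- \<alpha>))"
proof -
  let ?S = "\<Sum>\<^sub>\<infinity>n\<in>lattice. branch_power L (a + multi_dot d n w) (- \<alpha>)"
  have "((\<lambda>n. branch_power L (a + multi_dot d n w) (- \<alpha>)) has_sum ?S) lattice"
    using summable_on_branch_power[OF \<alpha>] by simp
  then have "(\<lambda>M. \<Sum>n\<in>cube M. branch_power L (a + multi_dot d n w) (- \<alpha>)) \<longlonglongrightarrow> ?S"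
    unfolding has_sum_def by (rule filterlim_compose) (rule filterlim_cube_finite_subsets, simp)
  then have "(\<lambda>M. \<Sum>n\<in>cube M. kernel d \<alpha> (a + multi_dot d n w)) \<longlonglongrightarrow> pole_factor \<alpha> * ?S"
    unfolding kernel_d sum_distrib_left[symmetric] by (rule tendsto_mult_left)
  moreover have "(\<lambda>M. alt_subset_sum d (\<lambda>x. primitive N \<alpha> (a + x)) (\<lambda>i. of_nat M * w i)) \<longlonglongrightarrow> 0"
    unfolding alt_subset_sum_def primitive_def
    by (intro tendsto_null_sum tendsto_mult_right_zero kernel_tendsto_0 \<alpha>) auto
  ultimately have "(\<lambda>M. approximant N M \<alpha>) \<longlonglongrightarrow> pole_factor \<alpha> * ?S - 0"
    unfolding approximant_eq by (rule tendsto_diff)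
  moreover have "(\<lambda>M. approximant N M \<alpha>) \<longlonglongrightarrow> continuation N \<alpha>"
    using \<alpha> by (intro approximant_tendsto) simp
  ultimately show ?thesis using LIMSEQ_unique by fastforce
qed

subsection \<open>Meromorphic continuation\<close>

text \<open>Both functions equal the same series for Re \<alpha> > d, and the smaller of their two
  half-planes is connected.\<close>

lemma continuation_unique:
  assumes "N \<le> N'" "Re \<alpha> > real d - real N - 1"
  shows "continuation N \<alpha> = continuation N' \<alpha>"
proof (rule analytic_continuation_open[where s = "{\<alpha>. Re \<alpha> > real d}" and
      s' = "{\<alpha>. Re \<alpha> > real d - real N - 1}" and f = "continuation N" and g = "continuation N'" and z = \<alpha>])
  have "of_nat (Suc d) \<in> {\<alpha>. Re \<alpha> > real d}" by simp
  then show "{\<alpha>. Re \<alpha> > real d} \<noteq> {}" by blast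
  show "connected {\<alpha>. Re \<alpha> > real d - real N - 1}"
    by (intro convex_connected convex_halfspace_Re_gt)
  show "continuation N' holomorphic_on {\<alpha>. Re \<alpha> > real d - real N - 1}"
    by (rule holomorphic_on_subset[OF continuation_holomorphic]) (use assms in auto)
  show "continuation N z = continuation N' z" if "z \<in> {\<alpha>. Re \<alpha> > real d}" for z
    using that continuation_eq_series by simp
qed (use assms in \<open>auto intro: open_Re_gt continuation_holomorphic\<close>)

text \<open>The order depends on \<alpha> and is large enough for \<alpha> to lie in its half-plane;
  by \<open>continuation_unique\<close> the values do not depend on this choice.\<close>

definition entire_continuation :: "complex \<Rightarrow> complex" where
  "entire_continuation \<alpha> = continuation (nat \<lceil>real d - Re \<alpha>\<rceil>) \<alpha>"

lemma entire_continuation_eq: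
  assumes "Re \<alpha> > real d - real N - 1"
  shows "entire_continuation \<alpha> = continuation N \<alpha>"
proof -
  let ?N = "nat \<lceil>real d - Re \<alpha>\<rceil>"
  have "Re \<alpha> > real d - real ?N - 1"
    using real_nat_ceiling_ge[of "real d - Re \<alpha>"] by linarith
  then have "continuation ?N \<alpha> = continuation N \<alpha>"
    using assms continuation_unique[of N ?N \<alpha>] continuation_unique[of ?N N \<alpha>]
    by (cases "N \<le> ?N") (simp_all only: nat_le_linear linorder_not_le less_imp_le)
  then show ?thesis by (simp only: entire_continuation_def)
qed

lemma entire_continuation_holomorphic: "entire_continuation holomorphic_on UNIV"
proof -
  have "entire_continuation holomorphic_on (\<Union>N. {\<alpha>. Re \<alpha> > real d - real N - 1})"
  proof (rule holomorphic_on_UN_open)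
    fix N
    show "entire_continuation holomorphic_on {\<alpha>. Re \<alpha> > real d - real N - 1}"
      by (rule holomorphic_transform[OF continuation_holomorphic]) (simp add: entire_continuation_eq)
  qed (rule open_Re_gt)
  moreover have "(\<Union>N. {\<alpha>. Re \<alpha> > real d - real N - 1}) = UNIV"
  proof -
    have "\<exists>N. Re \<alpha> > real d - real N - 1" for \<alpha>
    proof -
      obtain N where "real d - Re \<alpha> < real N" using reals_Archimedean2 by blast
      then have "Re \<alpha> > real d - real N - 1" by linarith
      then show ?thesis by blast
    qed
    then show ?thesis by auto
  qed
  ultimately show ?thesis by simp
qed

lemma pole_factor_holomorphic: "pole_factor holomorphic_on A"
  unfolding pole_factor_def by (intro holomorphic_intros)

lemma pole_factor_nonzero:
  assumes "Re \<alpha> < 1 \<or> Re \<alpha> > real d"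
  shows "pole_factor \<alpha> \<noteq> 0"
proof
  assume "pole_factor \<alpha> = 0"
  then obtain i where "i < d" "of_nat d - of_nat i - \<alpha> = 0" by (auto simp: pole_factor_def)
  then have "\<alpha> = of_nat (d - i)" by (simp add: of_nat_diff)
  then show False using assms \<open>i < d\<close> by auto
qed

text \<open>The quotient continues the series. Since x / 0 = 0, its raw value may be wrong where a
  zero of the numerator cancels one of \<open>pole_factor\<close>; \<open>remove_sings\<close>
  restores the normalisation required by \<open>barnes_zeta\<close>.\<close>

lemma barnes_zeta_eq: "barnes_zeta L d \<alpha> a w = remove_sings (\<lambda>\<alpha>. entire_continuation \<alpha> / pole_factor \<alpha>) \<alpha>"
proof -
  let ?F = "\<lambda>\<alpha>. entire_continuation \<alpha> / pole_factor \<alpha>"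
  let ?P = "\<lambda>Z. Z nicely_meromorphic_on UNIV \<and> (\<forall>s. Re s > real d \<longrightarrow>
           ((\<lambda>n. branch_power L (a + multi_dot d n w) (- s)) has_sum Z s) lattice)"
  have an: "?F analytic_on {s}" if "Re s < 1 \<or> Re s > real d" for s
    using pole_factor_nonzero[OF that]
    by (intro analytic_intros holomorphic_on_imp_analytic_at[OF entire_continuation_holomorphic]
        holomorphic_on_imp_analytic_at[OF pole_factor_holomorphic[of UNIV]]) auto
  have "?F meromorphic_on UNIV"
    by (intro meromorphic_intros analytic_on_imp_meromorphic_on)
       (auto simp: analytic_on_open intro: entire_continuation_holomorphic pole_factor_holomorphic)
  then have nice: "remove_sings ?F nicely_meromorphic_on UNIV"
    by (rule remove_sings_nicely_meromorphic)
  have "((\<lambda>n. branch_power L (a + multi_dot d n w) (- s)) has_sum remove_sings ?F s) lattice"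
    if s: "Re s > real d" for s
  proof -
    have "remove_sings ?F s = entire_continuation s / pole_factor s"
      using an s by (subst remove_sings_at_analytic) auto
    also have "entire_continuation s = continuation 0 s" using s by (intro entire_continuation_eq) simp
    also have "\<dots> / pole_factor s = (\<Sum>\<^sub>\<infinity>n\<in>lattice. branch_power L (a + multi_dot d n w) (- s))"
      using continuation_eq_series[OF s] pole_factor_nonzero[of s] s by simp
    finally show ?thesis using summable_on_branch_power[OF s] by simp
  qed
  with nice have P: "?P (remove_sings ?F)" by blast
  have "(THE Z. ?P Z) = remove_sings ?F"
  proof (rule the_equality[where P = ?P])
    show "?P (remove_sings ?F)" by (fact P)
    fix Z assume Z: "?P Z"
    show "Z = remove_sings ?F"
    proof (rule nicely_meromorphic_on_unique)
      show "open {\<alpha>. Re \<alpha> > real d}" by (rule open_Re_gt)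
      show "of_nat (Suc d) \<in> {\<alpha>. Re \<alpha> > real d}" by simp
      fix s assume "s \<in> {\<alpha>. Re \<alpha> > real d}"
      then show "Z s = remove_sings ?F s"
        using Z P by (metis (no_types, lifting) has_sum_unique mem_Collect_eq)
    qed (use Z P in auto)
  qed
  then show ?thesis by (simp add: barnes_zeta_def)
qed

lemma barnes_zeta_near_0:
  assumes "Re \<alpha> < 1" "Re \<alpha> > - 1"
  shows "barnes_zeta L d \<alpha> a w = continuation d \<alpha> / pole_factor \<alpha>"
proof -
  have "(\<lambda>\<alpha>. entire_continuation \<alpha> / pole_factor \<alpha>) analytic_on {\<alpha>}"
    using pole_factor_nonzero[of \<alpha>] assms
    by (intro analytic_intros holomorphic_on_imp_analytic_at[OF entire_continuation_holomorphic]
        holomorphic_on_imp_analytic_at[OF pole_factor_holomorphic[of UNIV]]) auto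
  then show ?thesis
    using assms by (simp add: barnes_zeta_eq entire_continuation_eq[of d])
qed

end

subsection \<open>The derivative at zero\<close>

text \<open>The logarithmic derivative at 0 is minus the sum of the 1/j. This is where all harmonic
  numbers come from.\<close>

lemma has_field_derivative_prod_of_nat_minus:
  "((\<lambda>\<alpha>. \<Prod>j=1..k. of_nat j - \<alpha>) has_field_derivative - (fact k * harm k)) (at (0 :: complex))"
proof (induction k)
  case 0
  then show ?case by (simp add: harm_def)
next
  case (Suc k)
  have "((\<lambda>\<alpha>. (\<Prod>j=1..k. of_nat j - \<alpha>) * (of_nat (Suc k) - \<alpha>)) has_field_derivative
      - (fact k * harm k) * (of_nat (Suc k) - 0) + (- 1) * (\<Prod>j=1..k. of_nat j - 0)) (at (0 :: complex))"
    by (rule DERIV_mult[OF Suc.IH]) (auto intro!: derivative_eq_intros)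
  moreover have Q: "(\<Prod>j=1..k. of_nat j - 0 :: complex) = fact k" by (simp add: fact_prod)
  have "- (fact k * harm k) * (of_nat (Suc k) - 0) + (- 1) * (\<Prod>j=1..k. of_nat j - 0) =
      - (fact (Suc k) * harm (Suc k) :: complex)"
    unfolding Q by (simp add: harm_Suc field_simps del: of_nat_Suc)
  ultimately show ?case by (simp add: prod.nat_ivl_Suc' mult.commute)
qed

context barnes_data
begin

lemma bernoullian_deriv0_eq_coef: "bernoullian_deriv0 d m w = fact m * coef m"
  using bernoullian_deriv0_eq[OF d_pos, of m w] by (simp add: coef_def)

text \<open>In the convolution identity for p = d only m = 0 survives, because the product of the
  e^(w_i z) - 1 starts at order d. It makes the leading coefficient in M exactly the harmonic
  number.\<close>

lemma coef_0: "coef 0 * (\<Prod>i=1..d. w i) = 1"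
proof -
  define E where "E = (\<Prod>i=1..d. fps_exp (w i) - 1)"
  have E0: "fps_nth E i = 0" if "i < d" for i
    using that by (simp add: E_def prod_fps_exp_minus_1 fps_X_power_mult_nth)
  have Ed: "fps_nth E d = (\<Prod>i=1..d. w i)"
    using iterated_diff_power_card[of "{1..d}" w 0] iterated_diff_power_w[of d] by (simp add: E_def)
  have "1 = (\<Sum>m\<le>d. coef m * fps_nth E (d - m))"
    using coef_convolution[of d] by (simp add: E_def)
  also have "\<dots> = (\<Sum>m\<in>{0}. coef m * fps_nth E (d - m))"
    by (rule sum.mono_neutral_right) (auto simp: E0)
  finally show ?thesis by (simp add: Ed)
qed

lemma pole_factor_split:
  assumes "m \<le> d"
  shows "pole_factor \<alpha> = (\<Prod>i<m. of_nat d - of_nat i - \<alpha>) * (\<Prod>j=1..d - m. of_nat j - \<alpha>)"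
proof -
  have "pole_factor \<alpha> = (\<Prod>i<m. of_nat d - of_nat i - \<alpha>) * (\<Prod>i=m..<d. of_nat d - of_nat i - \<alpha>)"
    unfolding pole_factor_def lessThan_atLeast0 using assms
    by (subst prod.atLeastLessThan_concat) auto
  also have "(\<Prod>i=m..<d. of_nat d - of_nat i - \<alpha>) = (\<Prod>j=1..d - m. of_nat j - \<alpha>)"
    by (rule prod.reindex_bij_witness[of _ "\<lambda>j. d - j" "\<lambda>i. d - i"])
       (auto simp: of_nat_diff)
  finally show ?thesis .
qed

text \<open>The first m factors cancel, and what is left is the (d - m)-fold antiderivative of
  y^(-\<alpha>), regular near \<alpha> = 0.\<close>

lemma kernel_over_pole_factor:
  assumes "m \<le> d" "Re \<alpha> < 1"
  shows "kernel m \<alpha> y / pole_factor \<alpha> = exp ((of_nat (d - m) - \<alpha>) * L y) / (\<Prod>j=1..d - m. of_nat j - \<alpha>)"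
proof -
  have "pole_factor \<alpha> \<noteq> 0" using assms by (intro pole_factor_nonzero) simp
  then show ?thesis
    using assms by (simp add: kernel_def pole_factor_split[OF assms(1)] of_nat_diff)
qed

lemma kernel_over_pole_factor_deriv:
  assumes m: "m \<le> d" and y: "y \<in> half_plane \<theta>"
  shows "((\<lambda>\<alpha>. kernel m \<alpha> y / pole_factor \<alpha>) has_field_derivative
    y ^ (d - m) * (harm (d - m) - L y) / fact (d - m)) (at 0)"
proof -
  define k where "k = d - m"
  have "exp (L y) = y" using branch y by (simp add: log_branch_on_def)
  then have pow: "exp (of_nat k * L y) = y ^ k" by (simp add: exp_of_nat_mult)
  have Q0: "(\<Prod>j=1..k. of_nat j - 0 :: complex) = fact k" by (simp add: fact_prod)
  have "((\<lambda>\<alpha>. exp ((of_nat k - \<alpha>) * L y)) has_field_derivative - L y * y ^ k) (at 0)"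
    by (auto intro!: derivative_eq_intros simp: pow)
  then have "((\<lambda>\<alpha>. exp ((of_nat k - \<alpha>) * L y) / (\<Prod>j=1..k. of_nat j - \<alpha>)) has_field_derivative
      ((- L y * y ^ k) * (\<Prod>j=1..k. of_nat j - 0) - exp ((of_nat k - 0) * L y) * - (fact k * harm k)) /
      ((\<Prod>j=1..k. of_nat j - 0) * (\<Prod>j=1..k. of_nat j - 0))) (at 0)"
    by (rule DERIV_divide[OF _ has_field_derivative_prod_of_nat_minus]) (simp add: Q0[simplified])
  also have "((- L y * y ^ k) * (\<Prod>j=1..k. of_nat j - 0) - exp ((of_nat k - 0) * L y) * - (fact k * harm k)) /
      ((\<Prod>j=1..k. of_nat j - 0) * (\<Prod>j=1..k. of_nat j - 0)) = y ^ k * (harm k - L y) / fact k"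
    unfolding Q0 by (simp only: diff_zero pow) (simp add: field_simps)
  finally show ?thesis
    unfolding k_def
    by (rule has_field_derivative_transform_within_open[where S = "{\<alpha>. Re \<alpha> < 1}"])
       (auto simp: open_halfspace_Re_lt kernel_over_pole_factor[OF m])
qed

definition log_expansion :: "nat \<Rightarrow> complex" where
  "log_expansion M = - harm d * of_nat M ^ d
      + (\<Sum>m=0..d. bernoullian_deriv0 d m w / (fact m * fact (d - m))
           * alt_subset_sum d (\<lambda>x. (a + x) ^ (d - m) * L (a + x)) (\<lambda>i. of_nat M * w i))
      - (\<Sum>n\<in>cube M. L (a + multi_dot d n w))"

definition harmonic_term :: complex where
  "harmonic_term = (-1) ^ d * (\<Sum>m=0..d. bernoullian_deriv0 d m w * harm (d - m)
                              / (fact m * fact (d - m)) * a ^ (d - m))"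

lemma subset_sum_in_half_plane:
  assumes "S \<subseteq> {1..d}" "S \<noteq> {}"
  shows "a + (\<Sum>i\<in>S. of_nat M * w i) \<in> half_plane \<theta>"
proof -
  have "0 < c0 * (1 + real M)" using c0_pos by simp
  also have "\<dots> \<le> \<rho> (a + (\<Sum>i\<in>S. of_nat M * w i))" by (rule coord_subset_sum_ge[OF assms])
  finally show ?thesis by (simp add: half_plane_iff)
qed

text \<open>This is a d-fold difference with steps M w_i minus its empty-subset term. The difference
  kills degrees below d and is constant in degree d.\<close>

lemma alt_subset_sum_power_scaled:
  assumes "k \<le> d"
  shows "alt_subset_sum d (\<lambda>x. (a + x) ^ k) (\<lambda>i. of_nat M * w i) =
    (if k = d then fact d * of_nat M ^ d * (\<Prod>i=1..d. w i) else 0) - (-1) ^ d * a ^ k"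
proof -
  let ?v = "\<lambda>i. of_nat M * w i"
  have "alt_subset_sum d (\<lambda>x. (a + x) ^ k) ?v = iterated_diff {1..d} ?v (\<lambda>y. y ^ k) a - (-1) ^ d * a ^ k"
    by (simp add: iterated_diff_eq_alt_subset_sum[of d _ "\<lambda>y. y ^ k"] del: One_nat_def)
  also have "iterated_diff {1..d} ?v (\<lambda>y. y ^ k) a =
      (if k = d then fact d * of_nat M ^ d * (\<Prod>i=1..d. w i) else 0)"
    using iterated_diff_power_card[of "{1..d}" ?v a] iterated_diff_power_less[of "{1..d}" k ?v a] assms
    by (simp add: prod.distrib)
  finally show ?thesis .
qed

text \<open>Differentiating y^(d-m-\<alpha>) over its product of factors gives a logarithm from the
  power and a harmonic number from the denominator. The logarithms form the bracket; the harmonic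
  part involves only powers and is evaluated in closed form.\<close>

lemma approximant_over_pole_factor_deriv:
  "((\<lambda>\<alpha>. approximant d M \<alpha> / pole_factor \<alpha>) has_field_derivative
     log_expansion M + harmonic_term) (at 0)"
proof -
  let ?v = "\<lambda>i. of_nat M * w i"
  let ?T = "{S. S \<noteq> {} \<and> S \<subseteq> {1..d}}"
  let ?y = "\<lambda>S. a + (\<Sum>i\<in>S. of_nat M * w i)"
  let ?Y = "\<lambda>n. a + multi_dot d n w"
  define \<kappa> where "\<kappa> m y = y ^ (d - m) * (harm (d - m) - L y) / fact (d - m)" for m y
  have "((\<lambda>\<alpha>. (\<Sum>n\<in>cube M. branch_power L (?Y n) (- \<alpha>)) -
      (\<Sum>S\<in>?T. (-1) ^ (d - card S) * (\<Sum>m\<le>d. coef m * (kernel m \<alpha> (?y S) / pole_factor \<alpha>))))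
      has_field_derivative (\<Sum>n\<in>cube M. - L (?Y n)) -
      (\<Sum>S\<in>?T. (-1) ^ (d - card S) * (\<Sum>m\<le>d. coef m * \<kappa> m (?y S)))) (at 0)"
    unfolding branch_power_def \<kappa>_def
    by (intro DERIV_diff DERIV_sum DERIV_cmult kernel_over_pole_factor_deriv subset_sum_in_half_plane)
       (auto intro!: derivative_eq_intros)
  then have deriv: "((\<lambda>\<alpha>. approximant d M \<alpha> / pole_factor \<alpha>) has_field_derivative
      (\<Sum>n\<in>cube M. - L (?Y n)) -
      (\<Sum>S\<in>?T. (-1) ^ (d - card S) * (\<Sum>m\<le>d. coef m * \<kappa> m (?y S)))) (at 0)"
  proof (rule has_field_derivative_transform_within_open[where S = "{\<alpha>. Re \<alpha> < 1}"])
    fix \<alpha> :: complex assume "\<alpha> \<in> {\<alpha>. Re \<alpha> < 1}"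
    then have "pole_factor \<alpha> \<noteq> 0" by (intro pole_factor_nonzero) simp
    then show "(\<Sum>n\<in>cube M. branch_power L (?Y n) (- \<alpha>)) -
      (\<Sum>S\<in>?T. (-1) ^ (d - card S) * (\<Sum>m\<le>d. coef m * (kernel m \<alpha> (?y S) / pole_factor \<alpha>))) =
      approximant d M \<alpha> / pole_factor \<alpha>"
      unfolding approximant_eq kernel_d alt_subset_sum_def primitive_def
      by (simp add: diff_divide_distrib sum_divide_distrib sum_distrib_left)
  qed (auto simp: open_halfspace_Re_lt)
  have "(\<Sum>S\<in>?T. (-1) ^ (d - card S) * (\<Sum>m\<le>d. coef m * \<kappa> m (?y S))) =
      (\<Sum>m\<le>d. coef m / fact (d - m) * (harm (d - m) * alt_subset_sum d (\<lambda>x. (a + x) ^ (d - m)) ?v -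
        alt_subset_sum d (\<lambda>x. (a + x) ^ (d - m) * L (a + x)) ?v))"
    unfolding alt_subset_sum_def \<kappa>_def sum_distrib_left sum_subtractf[symmetric]
    by (subst sum.swap) (intro sum.cong refl, simp add: field_simps)
  also have "\<dots> = (\<Sum>m\<le>d. coef m * harm (d - m) / fact (d - m) * alt_subset_sum d (\<lambda>x. (a + x) ^ (d - m)) ?v) -
      (\<Sum>m\<le>d. coef m / fact (d - m) * alt_subset_sum d (\<lambda>x. (a + x) ^ (d - m) * L (a + x)) ?v)"
    unfolding sum_subtractf[symmetric] by (intro sum.cong refl) (simp add: algebra_simps)
  \<comment> \<open>Only m = 0 reaches degree d and produces the multiple of M^d; the missing empty
    subset produces the powers of \<open>a\<close>, for every m.\<close>
  also have "(\<Sum>m\<le>d. coef m * harm (d - m) / fact (d - m) * alt_subset_sum d (\<lambda>x. (a + x) ^ (d - m)) ?v) =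
      (\<Sum>m\<le>d. if m = 0 then coef 0 * (\<Prod>i=1..d. w i) * harm d * of_nat M ^ d else 0) -
      (-1) ^ d * (\<Sum>m\<le>d. coef m * harm (d - m) / fact (d - m) * a ^ (d - m))"
    unfolding sum_distrib_left sum_subtractf[symmetric]
  proof (intro sum.cong refl)
    fix m assume "m \<in> {..d}"
    then have "d - m = d \<longleftrightarrow> m = 0" using d_pos by auto
    then show "coef m * harm (d - m) / fact (d - m) * alt_subset_sum d (\<lambda>x. (a + x) ^ (d - m)) ?v =
      (if m = 0 then coef 0 * (\<Prod>i=1..d. w i) * harm d * of_nat M ^ d else 0) -
      (-1) ^ d * (coef m * harm (d - m) / fact (d - m) * a ^ (d - m))"
      by (simp add: alt_subset_sum_power_scaled right_diff_distrib mult_ac)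
  qed
  also have "(\<Sum>m\<le>d. if m = 0 then coef 0 * (\<Prod>i=1..d. w i) * harm d * of_nat M ^ d else 0) =
      harm d * of_nat M ^ d"
    by (simp only: coef_0) simp
  finally have "(\<Sum>n\<in>cube M. - L (?Y n)) -
      (\<Sum>S\<in>?T. (-1) ^ (d - card S) * (\<Sum>m\<le>d. coef m * \<kappa> m (?y S))) = log_expansion M + harmonic_term"
    by (simp add: log_expansion_def harmonic_term_def bernoullian_deriv0_eq_coef sum_negf
        atMost_atLeast0 algebra_simps)
  with deriv show ?thesis by simp
qed

text \<open>With N = d the approximants converge locally uniformly for Re \<alpha> > -1, a
  neighbourhood of 0, so their derivatives converge as well.\<close>

lemma barnes_zeta_deriv_0:
  obtains D where "((\<lambda>\<alpha>. barnes_zeta L d \<alpha> a w) has_field_derivative D) (at 0)"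
    "(\<lambda>M. log_expansion M + harmonic_term) \<longlonglongrightarrow> D"
proof -
  let ?U = "{\<alpha>. Re \<alpha> > real d - real d - 1}"
  have pf: "pole_factor 0 \<noteq> 0" by (intro pole_factor_nonzero) simp
  obtain P' where P': "(pole_factor has_field_derivative P') (at 0)"
    using pole_factor_holomorphic[of UNIV] holomorphic_on_imp_differentiable_at
    by (metis UNIV_I field_differentiable_def open_UNIV)
  have "\<exists>g'. \<forall>\<alpha>\<in>?U. (continuation d has_field_derivative g' \<alpha>) (at \<alpha>) \<and>
      (\<lambda>M. deriv (approximant d M) \<alpha>) \<longlonglongrightarrow> g' \<alpha>"
  proof (rule has_complex_derivative_uniform_sequence[OF open_Re_gt])
    show "(approximant d M has_field_derivative deriv (approximant d M) \<alpha>) (at \<alpha>)" for M \<alpha>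
      by (rule holomorphic_derivI[OF approximant_holomorphic open_UNIV UNIV_I])
    show "\<exists>r>0. cball \<alpha> r \<subseteq> ?U \<and> uniform_limit (cball \<alpha> r) (approximant d) (continuation d) sequentially"
      if "\<alpha> \<in> ?U" for \<alpha>
      using that by (intro uniform_limit_approximant) simp
  qed
  then obtain W' where W': "(continuation d has_field_derivative W') (at 0)"
    "(\<lambda>M. deriv (approximant d M) 0) \<longlonglongrightarrow> W'" by fastforce
  \<comment> \<open>The quotient rule at 0 as a function of the value and derivative of the
    numerator. It is continuous in both, so the limit in M can be taken inside.\<close>
  define q where "q A A' = (A' * pole_factor 0 - A * P') / (pole_factor 0 * pole_factor 0)" for A A'
  have "((\<lambda>\<alpha>. approximant d M \<alpha> / pole_factor \<alpha>) has_field_derivative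
      q (approximant d M 0) (deriv (approximant d M) 0)) (at 0)" for M
    unfolding q_def
    by (rule DERIV_divide[OF holomorphic_derivI[OF approximant_holomorphic open_UNIV UNIV_I] P' pf])
  then have q: "q (approximant d M 0) (deriv (approximant d M) 0) = log_expansion M + harmonic_term" for M
    using approximant_over_pole_factor_deriv by (rule DERIV_unique)
  have "(\<lambda>M. approximant d M 0) \<longlonglongrightarrow> continuation d 0"
    by (rule approximant_tendsto) simp
  then have "(\<lambda>M. q (approximant d M 0) (deriv (approximant d M) 0)) \<longlonglongrightarrow> q (continuation d 0) W'"
    unfolding q_def using W'(2) pf by (intro tendsto_intros) auto
  moreover have "((\<lambda>\<alpha>. barnes_zeta L d \<alpha> a w) has_field_derivative q (continuation d 0) W') (at 0)"
  proof (rule has_field_derivative_transform_within_open[where S = "{\<alpha>. Re \<alpha> < 1} \<inter> {\<alpha>. Re \<alpha> > - 1}"])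
    show "((\<lambda>\<alpha>. continuation d \<alpha> / pole_factor \<alpha>) has_field_derivative q (continuation d 0) W') (at 0)"
      unfolding q_def by (rule DERIV_divide[OF W'(1) P' pf])
    show "open ({\<alpha>. Re \<alpha> < 1} \<inter> {\<alpha>. Re \<alpha> > - 1})"
      by (intro open_Int open_halfspace_Re_lt open_halfspace_Re_gt)
  qed (auto simp: barnes_zeta_near_0)
  ultimately show ?thesis using that unfolding q by blast
qed

end

theorem mainTheorem4:
  fixes \<theta> :: real and L :: "complex \<Rightarrow> complex"
    and d :: nat and a :: complex and w :: "nat \<Rightarrow> complex"
  assumes "log_branch_on L (half_plane \<theta>)"
    and "d \<ge> 1"
    and "a \<in> half_plane \<theta>"
    and "\<And>i. i \<in> {1..d} \<Longrightarrow> w i \<in> half_plane \<theta>"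
  defines "X \<equiv> (\<lambda>M::nat.
      - harm d * of_nat M ^ d
      + (\<Sum>m=0..d. bernoullian_deriv0 d m w / (fact m * fact (d - m))
           * alt_subset_sum d (\<lambda>x. (a + x) ^ (d - m) * L (a + x)) (\<lambda>i. of_nat M * w i))
      - (\<Sum>n\<in>multi_cube d (M - 1). L (a + multi_dot d n w)))"
  shows "convergent X \<and>
    ((\<lambda>\<alpha>. barnes_zeta L d \<alpha> a w) has_field_derivative
       lim X + (-1) ^ d * (\<Sum>m=0..d. bernoullian_deriv0 d m w * harm (d - m)
                              / (fact m * fact (d - m)) * a ^ (d - m))) (at 0)"
proof -
  interpret barnes_data \<theta> L d a w
    by unfold_locales (use assms(1-4) in auto)
  obtain D where D: "((\<lambda>\<alpha>. barnes_zeta L d \<alpha> a w) has_field_derivative D) (at 0)"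
    "(\<lambda>M. log_expansion M + harmonic_term) \<longlonglongrightarrow> D"
    using barnes_zeta_deriv_0 by metis
  have "(\<lambda>M. log_expansion M + harmonic_term - harmonic_term) \<longlonglongrightarrow> D - harmonic_term"
    by (intro tendsto_diff D(2) tendsto_const)
  moreover have "\<forall>\<^sub>F M in sequentially. log_expansion M + harmonic_term - harmonic_term = X M"
    using eventually_gt_at_top[of 0]
  proof eventually_elim
    case (elim M)
    \<comment> \<open>This fails at M = 0, where truncated subtraction gives the one-element set
      {0}; hence the agreement is only eventual.\<close>
    then have "{0..M - 1} = {..<M}" by auto
    then show ?case by (simp add: log_expansion_def X_def multi_cube_def)
  qed
  ultimately have X: "X \<longlonglongrightarrow> D - harmonic_term" by (rule Lim_transform_eventually)
  then have "lim X + harmonic_term = D" by (simp add: limI)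
  with X D(1) show ?thesis by (auto simp: convergent_def harmonic_term_def)
qed

end
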